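(* Let $f:\Theta\times\mathbb{T}^1\to\Theta\times\mathbb{T}^1$ be a UEF circle endomorphism, homotopic to the identity, with continuous lift $F:\Theta\times\mathbb{R}\to\Theta\times\mathbb{R}$. If $\rho_{\mathrm{fib}}(F)$ has non-empty interior (as a subset of $\mathbb{R}$), then $h_{\mathrm{top}}(f)>0$.
   Context: $\mathbb{T}^1=\mathbb{R}/\mathbb{Z}$ is the circle. $\Theta$ is a compact metric space and $r:\Theta\to\Theta$ is a continuous map. A UEF (uniquely ergodically forced) circle endomorphism is a continuous map $f:\Theta\times\mathbb{T}^1\to\Theta\times\mathbb{T}^1$ of the form $f(\theta,\varphi)=(r(\theta),f_\theta(\varphi))$, where $r$ has a unique invariant Borel probability measure. Such an $f$ is called homotopic to the identity if it is homotopic to the map $(\theta,\varphi)\mapsto(r(\theta),\varphi)$. In that case all fibre maps $f_\theta$ have degree one and there exist continuous lifts $F:\Theta\times\mathbb{R}\to\Theta\times\mathbb{R}$, $F(\theta,x)=(r(\theta),F_\theta(x))$, with $\pi\circ F=f\circ\pi$, where $\pi:\Theta\times\mathbb{R}\to\Theta\times\mathbb{T}^1$ is the natural projection. Write $F^n_\theta=F_{r^{n-1}(\theta)}\circ\cdots\circ F_{r(\theta)}\circ F_\theta$. The fibred rotation interval of $F$ is $$\rho_{\mathrm{fib}}(F)=\left\{\limsup_{n\to\infty}\tfrac1n\left(F^n_\theta(x)-x\right)\ \middle|\ (\theta,x)\in\Theta\times\mathbb{R}\right\}.$$ $h_{\mathrm{top}}$ denotes topological entropy. *)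

theory Defs
  imports "HOL-Probability.Probability"
begin

quotient_type circle = real / "\<lambda>x y :: real. x - y \<in> \<int>"
proof (intro equivpI reflpI sympI transpI)
  fix x y z :: real
  show "x - x \<in> \<int>" by simp
  show "y - x \<in> \<int>" if "x - y \<in> \<int>" using Ints_minus[OF that] by simp
  show "x - z \<in> \<int>" if "x - y \<in> \<int>" "y - z \<in> \<int>" using Ints_add[OF that] by simp
qed

lift_definition circle_proj :: "real \<Rightarrow> circle" is "\<lambda>x. x" .

lemma circle_proj_eq_iff: "circle_proj x = circle_proj y \<longleftrightarrow> x - y \<in> \<int>"
  by transfer simp

lemma circle_proj_surj: "\<exists>x. c = circle_proj x"
  by transfer (metis Ints_0 diff_self)

lemma INF_int_shift_eq_round:
  "(INF k::int. \<bar>t + of_int k\<bar>) = \<bar>t - of_int (round t)\<bar>" for t :: real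
proof (rule cInf_eq_minimum)
  show "\<bar>t - of_int (round t)\<bar> \<in> range (\<lambda>k::int. \<bar>t + of_int k\<bar>)"
    by (rule image_eqI[of _ _ "- round t"]) simp_all
  fix s assume "s \<in> range (\<lambda>k::int. \<bar>t + of_int k\<bar>)"
  then obtain k :: int where "s = \<bar>t - of_int (- k)\<bar>" by auto
  then show "\<bar>t - of_int (round t)\<bar> \<le> s" using round_diff_minimal by blast
qed

instantiation circle :: metric_space
begin

lift_definition dist_circle :: "circle \<Rightarrow> circle \<Rightarrow> real"
  is "\<lambda>x y. INF k::int. \<bar>x - y + of_int k\<bar>"
proof -
  fix x x' y y' :: real
  assume "x - x' \<in> \<int>" "y - y' \<in> \<int>"
  then obtain m n :: int where x: "x = x' + of_int m" and y: "y = y' + of_int n"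
    by (metis Ints_cases add.commute diff_add_cancel)
  have "range (\<lambda>k::int. \<bar>x - y + of_int k\<bar>) = (\<lambda>k::int. \<bar>x' - y' + of_int k\<bar>) ` range (\<lambda>k. k + (m - n))"
    unfolding image_image by (intro image_cong) (simp_all add: x y algebra_simps)
  also have "range (\<lambda>k::int. k + (m - n)) = UNIV"
    by (metis surj_plus_right)
  finally show "(INF k::int. \<bar>x - y + of_int k\<bar>) = (INF k::int. \<bar>x' - y' + of_int k\<bar>)"
    by simp
qed

definition uniformity_circle :: "(circle \<times> circle) filter"
  where "uniformity_circle = (INF e\<in>{0<..}. principal {(x, y). dist x y < e})"

definition open_circle :: "circle set \<Rightarrow> bool"
  where "open_circle U \<longleftrightarrow> (\<forall>x\<in>U. \<forall>\<^sub>F (x', y) in uniformity. x' = x \<longrightarrow> y \<in> U)"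

instance
proof
  fix x y z :: circle
  show "dist x y = 0 \<longleftrightarrow> x = y"
  proof (transfer, unfold INF_int_shift_eq_round)
    fix x y :: real
    show "\<bar>x - y - of_int (round (x - y))\<bar> = 0 \<longleftrightarrow> x - y \<in> \<int>"
      by (auto elim!: Ints_cases) (metis Ints_of_int)
  qed
  show "dist x y \<le> dist x z + dist y z"
  proof (transfer, unfold INF_int_shift_eq_round)
    fix x y z :: real
    let ?k = "round (x - z) - round (y - z)"
    have "\<bar>x - y - of_int (round (x - y))\<bar> \<le> \<bar>x - y - of_int ?k\<bar>"
      by (rule round_diff_minimal)
    then show "\<bar>x - y - of_int (round (x - y))\<bar>
        \<le> \<bar>x - z - of_int (round (x - z))\<bar> + \<bar>y - z - of_int (round (y - z))\<bar>"
      by simp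
  qed
qed (simp_all add: uniformity_circle_def open_circle_def)

end

lemma dist_circle_proj: "dist (circle_proj x) (circle_proj y) = (INF k::int. \<bar>x - y + of_int k\<bar>)"
  by transfer simp

lemma dist_circle_proj_le: "dist (circle_proj x) (circle_proj y) \<le> dist x y"
  unfolding dist_circle_proj INF_int_shift_eq_round dist_real_def
  using round_diff_minimal[of "x - y" 0] by simp

text \<open>The metric induces the quotient topology.\<close>

lemma open_circle_iff: "open U \<longleftrightarrow> open (circle_proj -` U)"
proof
  assume U: "open U"
  show "open (circle_proj -` U)"
    unfolding open_dist
  proof
    fix x assume "x \<in> circle_proj -` U"
    then obtain e where "e > 0" "\<And>c. dist c (circle_proj x) < e \<Longrightarrow> c \<in> U"
      using U unfolding open_dist by auto
    then show "\<exists>e>0. \<forall>y. dist y x < e \<longrightarrow> y \<in> circle_proj -` U"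
      using dist_circle_proj_le by (intro exI[of _ e]) (auto intro: le_less_trans)
  qed
next
  assume V: "open (circle_proj -` U)"
  show "open U"
    unfolding open_dist
  proof
    fix c assume "c \<in> U"
    moreover obtain x where c: "c = circle_proj x" using circle_proj_surj by blast
    ultimately obtain e where e: "e > 0" "\<And>y. dist y x < e \<Longrightarrow> circle_proj y \<in> U"
      using V unfolding open_dist by auto
    have "d \<in> U" if "dist d c < e" for d
    proof -
      obtain y where d: "d = circle_proj y" using circle_proj_surj by blast
      let ?y = "y - of_int (round (y - x))"
      have "dist ?y x < e"
        using that unfolding d c dist_circle_proj INF_int_shift_eq_round dist_real_def
        by (simp add: algebra_simps)
      moreover have "circle_proj ?y = d" unfolding d circle_proj_eq_iff by simp
      ultimately show ?thesis using e by metis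
    qed
    with e show "\<exists>e>0. \<forall>d. dist d c < e \<longrightarrow> d \<in> U" by blast
  qed
qed

text \<open>Bowen--Dinaburg definition. On a compact metric space it depends only on the topology.\<close>

definition separated_set :: "('a::metric_space \<Rightarrow> 'a) \<Rightarrow> nat \<Rightarrow> real \<Rightarrow> 'a set \<Rightarrow> bool" where
  "separated_set f n \<epsilon> E \<longleftrightarrow>
     (\<forall>x\<in>E. \<forall>y\<in>E. x \<noteq> y \<longrightarrow> (\<exists>i<n. dist ((f ^^ i) x) ((f ^^ i) y) > \<epsilon>))"

text \<open>The limit as \<open>\<epsilon>\<close> tends to 0 is a supremum, because the growth rate is antitone in \<open>\<epsilon>\<close>.\<close>

definition top_entropy :: "('a::metric_space \<Rightarrow> 'a) \<Rightarrow> ereal" where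
  "top_entropy f =
     (SUP \<epsilon>\<in>{0<..}. limsup (\<lambda>n.
        (SUP E\<in>{E. finite E \<and> separated_set f n \<epsilon> E}. ereal (ln (real (card E)))) / ereal (real n)))"

definition invariant_prob :: "('a::topological_space \<Rightarrow> 'a) \<Rightarrow> 'a measure \<Rightarrow> bool" where
  "invariant_prob r \<mu> \<longleftrightarrow> prob_space \<mu> \<and> sets \<mu> = sets borel \<and> distr \<mu> borel r = \<mu>"

definition uniquely_ergodic :: "('a::topological_space \<Rightarrow> 'a) \<Rightarrow> bool" where
  "uniquely_ergodic r \<longleftrightarrow> (\<exists>!\<mu>. invariant_prob r \<mu>)"

definition uef_circle_endo ::
  "('a::metric_space \<Rightarrow> 'a) \<Rightarrow> ('a \<times> circle \<Rightarrow> 'a \<times> circle) \<Rightarrow> bool" where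
  "uef_circle_endo r f \<longleftrightarrow>
     continuous_on UNIV r \<and> uniquely_ergodic r \<and>
     continuous_on UNIV f \<and> (\<forall>\<theta> \<phi>. fst (f (\<theta>, \<phi>)) = r \<theta>)"

text \<open>The homotopy is an arbitrary one; it need not preserve the fibred structure.\<close>

definition homotopic_to_identity ::
  "('a::metric_space \<Rightarrow> 'a) \<Rightarrow> ('a \<times> circle \<Rightarrow> 'a \<times> circle) \<Rightarrow> bool" where
  "homotopic_to_identity r f \<longleftrightarrow>
     homotopic_with_canon (\<lambda>_. True) UNIV UNIV f (\<lambda>(\<theta>, \<phi>). (r \<theta>, \<phi>))"

definition cover_proj :: "'a \<times> real \<Rightarrow> 'a \<times> circle" where
  "cover_proj = (\<lambda>(\<theta>, x). (\<theta>, circle_proj x))"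

definition continuous_lift ::
  "('a::metric_space \<Rightarrow> 'a) \<Rightarrow> ('a \<times> circle \<Rightarrow> 'a \<times> circle) \<Rightarrow> ('a \<times> real \<Rightarrow> 'a \<times> real) \<Rightarrow> bool" where
  "continuous_lift r f F \<longleftrightarrow>
     continuous_on UNIV F \<and> (\<forall>\<theta> x. fst (F (\<theta>, x)) = r \<theta>) \<and> cover_proj \<circ> F = f \<circ> cover_proj"

definition fibre_map :: "('a \<times> real \<Rightarrow> 'a \<times> real) \<Rightarrow> 'a \<Rightarrow> real \<Rightarrow> real" where
  "fibre_map F \<theta> x = snd (F (\<theta>, x))"

primrec fibre_iterate ::
  "('a \<Rightarrow> 'a) \<Rightarrow> ('a \<times> real \<Rightarrow> 'a \<times> real) \<Rightarrow> nat \<Rightarrow> 'a \<Rightarrow> real \<Rightarrow> real" where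
  "fibre_iterate r F 0 \<theta> = id"
| "fibre_iterate r F (Suc n) \<theta> = fibre_map F ((r ^^ n) \<theta>) \<circ> fibre_iterate r F n \<theta>"

text \<open>For a lift of a map homotopic to the identity on a compact base every upper limit below is
  finite, so taking it in the extended reals loses no points of the interval.\<close>

definition fibred_rotation_interval ::
  "('a \<Rightarrow> 'a) \<Rightarrow> ('a \<times> real \<Rightarrow> 'a \<times> real) \<Rightarrow> real set" where
  "fibred_rotation_interval r F =
     {\<rho>. \<exists>\<theta> x. ereal \<rho> = limsup (\<lambda>n. ereal ((fibre_iterate r F n \<theta> x - x) / real n))}"

end

theory Submission
  imports Defs "HOL-Complex_Analysis.Complex_Analysis"
begin

text \<open>
  For $n \ge 1$ let $M_n(\theta)$ and $m_n(\theta)$ be the maximal and minimal displacement of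
  $F^n_\theta$. By unique ergodicity the Birkhoff averages of these continuous functions converge
  along every orbit to constants $b_n$ and $a_n$, and telescoping along the orbit of $(\theta, x)$
  shows that every element $\rho$ of the rotation interval satisfies $a_n \le n \rho \le b_n$. Hence
  $b_n - a_n$ grows linearly in $n$, although different $\rho$ may come from different fibres. For
  large $n$ every orbit in the base therefore visits with positive frequency the set where
  $M_n - m_n \ge 4$. At such a visit $F^n_\theta$ maps a fundamental domain onto an interval of length
  3, so every point of the circle has two preimages under $f^n_\theta$ that become separated within
  $n$ steps; at all other times degree one still gives one preimage. Pulling back along the orbit
  doubles the number of separated points at each visit.
\<close>

section \<open>From finitely additive contents to measures\<close>

text \<open>Averages run over all times of an orbit, not only over multiples of n, because r^n need
  not be uniquely ergodic.

  That the averages agree over all orbits is proved by building invariant measures along prescribed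
  times. Limits of averages of indicators give an invariant content on all subsets that is only
  finitely additive. A Borel measure is recovered from the sets squeezed between closed and open
  ones, and these suffice to approximate continuous functions.

  Fibre maps need not be injective, so forward images of separated points may merge, whereas
  preimages of separated points stay separated. Hence the separated sets are built backwards, from
  the far end of the orbit.

  The constant 4 allows for a distance of at most 1 between the two extremal points, and the
  remaining 3 holds two lifts of each circle point that differ by exactly 2. A difference of 1 would
  not do: the endpoints of a fundamental domain have images that differ by 1, yet they are one point
  of the circle.\<close>

definition birkhoff_avg :: "('a \<Rightarrow> 'a) \<Rightarrow> ('a \<Rightarrow> real) \<Rightarrow> 'a \<Rightarrow> nat \<Rightarrow> real" where
  "birkhoff_avg r g \<theta> K = (\<Sum>i<K. g ((r ^^ i) \<theta>)) / real K"

lemma birkhoff_avg_add: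
  "birkhoff_avg r (\<lambda>x. g x + h x) \<theta> K = birkhoff_avg r g \<theta> K + birkhoff_avg r h \<theta> K"
  by (simp add: birkhoff_avg_def sum.distrib add_divide_distrib)

lemma birkhoff_avg_diff:
  "birkhoff_avg r (\<lambda>x. g x - h x) \<theta> K = birkhoff_avg r g \<theta> K - birkhoff_avg r h \<theta> K"
  by (simp add: birkhoff_avg_def sum_subtractf diff_divide_distrib)

lemma birkhoff_avg_sum_mult:
  "birkhoff_avg r (\<lambda>x. \<Sum>j\<in>S. c * g j x) \<theta> K = (\<Sum>j\<in>S. c * birkhoff_avg r (g j) \<theta> K)"
  unfolding birkhoff_avg_def sum_distrib_left sum_divide_distrib
  by (subst sum.swap) simp

lemma birkhoff_avg_abs_le:
  assumes "\<And>x. \<bar>g x\<bar> \<le> B"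
  shows "\<bar>birkhoff_avg r g \<theta> K\<bar> \<le> B"
proof (cases "K = 0")
  case True
  have "0 \<le> B" using assms[of \<theta>] by linarith
  then show ?thesis using True by (simp add: birkhoff_avg_def)
next
  case False
  have "\<bar>\<Sum>i<K. g ((r ^^ i) \<theta>)\<bar> \<le> (\<Sum>i<K. B)"
    by (rule order_trans[OF sum_abs]) (intro sum_mono assms)
  then show ?thesis using False by (simp add: birkhoff_avg_def field_simps)
qed

section \<open>Limits of the averages of all indicators at once\<close>

lemma compact_unit_cube: "compact (PiE UNIV (\<lambda>_::'i. {0..1::real}))"
proof -
  have "compactin (product_topology (\<lambda>_. euclidean) UNIV) (PiE UNIV (\<lambda>_::'i. {0..1::real}))"
    by (subst compactin_PiE) simp
  then show ?thesis by (simp add: euclidean_product_topology)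
qed

text \<open>
  The averages of all indicators at once are a point of the compact cube of functions from the power
  set to $[0,1]$; the refined filter takes the role of a convergent subsequence.
\<close>

lemma birkhoff_avg_cluster:
  assumes "G0 \<noteq> bot"
  obtains G m where "G \<le> G0" "G \<noteq> bot"
    "\<And>A. (birkhoff_avg r (indicator A) \<theta> \<longlongrightarrow> m A) G"
proof -
  define X where "X K A = birkhoff_avg r (indicator A) \<theta> K" for K and A :: "'a set"
  have X: "X K A \<in> {0..1}" for K A
    using birkhoff_avg_abs_le[of "indicator A" 1 r \<theta> K]
    by (auto simp: X_def birkhoff_avg_def sum_nonneg indicator_def)
  have "filtermap X G0 \<noteq> bot" using assms by (simp add: filtermap_bot_iff)
  moreover have "eventually (\<lambda>x. x \<in> PiE UNIV (\<lambda>_. {0..1})) (filtermap X G0)"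
    unfolding eventually_filtermap using X by (simp add: PiE_iff)
  ultimately obtain m where m: "inf (nhds m) (filtermap X G0) \<noteq> bot"
    using compact_unit_cube[unfolded compact_filter, rule_format, of "filtermap X G0"] by blast
  \<comment> \<open>\<open>G\<close> keeps the indices of \<open>G0\<close> at which
    \<open>X\<close> is near the cluster point \<open>m\<close>. A subsequence would not do in
    general: the cube is a product over all subsets of the base and need not be sequentially
    compact.\<close>
  define G where "G = inf (filtercomap X (nhds m)) G0"
  have "G \<noteq> bot"
  proof
    assume "G = bot"
    then have "eventually (\<lambda>_. False) G" by simp
    then obtain P Q where PQ: "eventually P (filtercomap X (nhds m))" "eventually Q G0"
      "\<And>k. P k \<Longrightarrow> Q k \<Longrightarrow> False"
      unfolding G_def eventually_inf by blast
    then obtain P' where P': "eventually P' (nhds m)" "\<And>k. P' (X k) \<Longrightarrow> P k"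
      unfolding eventually_filtercomap by blast
    have "eventually (\<lambda>x. \<not> P' x) (filtermap X G0)"
      unfolding eventually_filtermap using PQ(2) by eventually_elim (use P' PQ in blast)
    then have "eventually (\<lambda>_. False) (inf (nhds m) (filtermap X G0))"
      unfolding eventually_inf using P'(1) by blast
    then show False using m by (simp add: trivial_limit_def)
  qed
  moreover have "G \<le> G0" by (simp add: G_def)
  moreover have "(birkhoff_avg r (indicator A) \<theta> \<longlongrightarrow> m A) G" for A
  proof -
    have "filterlim X (nhds m) G"
      unfolding G_def by (rule filterlim_mono[OF filterlim_filtercomap order_refl inf_le1])
    moreover have "((\<lambda>x :: 'a set \<Rightarrow> real. x A) \<longlongrightarrow> m A) (nhds m)"
    proof (rule topological_tendstoI)
      fix S :: "real set" assume "open S" "m A \<in> S"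
      moreover have "open ((\<lambda>x :: 'a set \<Rightarrow> real. x A) -` S)"
        using \<open>open S\<close> continuous_on_product_coordinates[of A]
          continuous_on_open_vimage[of UNIV "\<lambda>x :: 'a set \<Rightarrow> real. x A"] by simp
      ultimately show "eventually (\<lambda>x. x A \<in> S) (nhds m)"
        unfolding eventually_nhds by (intro exI[of _ "(\<lambda>x. x A) -` S"]) simp
    qed
    ultimately have "((\<lambda>k. X k A) \<longlongrightarrow> m A) G"
      by (rule filterlim_compose[rotated])
    then show ?thesis by (simp add: X_def)
  qed
  ultimately show thesis using that by blast
qed

text \<open>
  The analogue of Jordan measurable sets. Approximation by closed sets from inside makes any finitely
  additive content on a compact space countably additive on them.
\<close>

definition squeezed_sets :: "('a::topological_space set \<Rightarrow> real) \<Rightarrow> 'a set set" where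
  "squeezed_sets m = {A \<in> sets borel.
     \<forall>e>0. \<exists>C U. closed C \<and> open U \<and> C \<subseteq> A \<and> A \<subseteq> U \<and> m (U - C) < e}"

text \<open>\<open>m\<close> is defined on all subsets because the limits above exist for all of
  them at once; measurability enters only with \<open>squeezed_sets\<close>.\<close>

locale fin_content =
  fixes m :: "'a::metric_space set \<Rightarrow> real"
  assumes compact_UNIV: "compact (UNIV :: 'a set)"
    and nonneg: "0 \<le> m A"
    and total: "m UNIV = 1"
    and additive: "A \<inter> B = {} \<Longrightarrow> m (A \<union> B) = m A + m B"
begin

lemma empty: "m {} = 0"
  using additive[of "{}" "{}"] by simp

lemma mono: "A \<subseteq> B \<Longrightarrow> m A \<le> m B"
  using additive[of A "B - A"] nonneg[of "B - A"] by (simp add: Un_absorb1)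

lemma diff: "A \<subseteq> B \<Longrightarrow> m (B - A) = m B - m A"
  using additive[of A "B - A"] by (simp add: Un_absorb1)

lemma subadditive: "m (A \<union> B) \<le> m A + m B"
  using additive[of A "B - A"] mono[of "B - A" B] by simp

lemma subadditive_UN: "finite I \<Longrightarrow> m (\<Union>i\<in>I. A i) \<le> (\<Sum>i\<in>I. m (A i))"
proof (induction rule: finite_induct)
  case (insert i I)
  then show ?case using subadditive[of "A i" "\<Union>i\<in>I. A i"] by simp
qed (simp add: empty)

lemma squeezed_setsE:
  assumes "A \<in> squeezed_sets m" "e > 0"
  obtains C U where "closed C" "open U" "C \<subseteq> A" "A \<subseteq> U" "m (U - C) < e"
  using assms unfolding squeezed_sets_def by blast

lemma squeezed_setsI:
  assumes "A \<in> sets borel"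
    "\<And>e. e > 0 \<Longrightarrow> \<exists>C U. closed C \<and> open U \<and> C \<subseteq> A \<and> A \<subseteq> U \<and> m (U - C) < e"
  shows "A \<in> squeezed_sets m"
  using assms unfolding squeezed_sets_def by simp

lemma algebra_squeezed: "algebra UNIV (squeezed_sets m)"
  unfolding algebra_iff_Un
proof (intro conjI ballI)
  show "{} \<in> squeezed_sets m"
    unfolding squeezed_sets_def using empty by (auto intro!: exI[of _ "{}"])
next
  fix A assume A: "A \<in> squeezed_sets m"
  have "\<exists>C U. closed C \<and> open U \<and> C \<subseteq> - A \<and> - A \<subseteq> U \<and> m (U - C) < e" if "e > 0" for e
  proof -
    obtain C U where "closed C" "open U" "C \<subseteq> A" "A \<subseteq> U" "m (U - C) < e"
      using squeezed_setsE[OF A \<open>e > 0\<close>] by blast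
    moreover have "(- C) - (- U) = U - C" by blast
    ultimately show ?thesis
      by (intro exI[of _ "- U"] exI[of _ "- C"]) auto
  qed
  moreover have "- A \<in> sets borel" using A by (simp add: squeezed_sets_def borel_comp)
  ultimately show "UNIV - A \<in> squeezed_sets m"
    unfolding Compl_eq_Diff_UNIV by (intro squeezed_setsI)
next
  fix A B assume A: "A \<in> squeezed_sets m" and B: "B \<in> squeezed_sets m"
  have "\<exists>C U. closed C \<and> open U \<and> C \<subseteq> A \<union> B \<and> A \<union> B \<subseteq> U \<and> m (U - C) < e" if "e > 0" for e
  proof -
    obtain C U where 1: "closed C" "open U" "C \<subseteq> A" "A \<subseteq> U" "m (U - C) < e/2"
      using squeezed_setsE[OF A half_gt_zero[OF \<open>e > 0\<close>]] by blast
    obtain D V where 2: "closed D" "open V" "D \<subseteq> B" "B \<subseteq> V" "m (V - D) < e/2"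
      using squeezed_setsE[OF B half_gt_zero[OF \<open>e > 0\<close>]] by blast
    have "m ((U \<union> V) - (C \<union> D)) \<le> m ((U - C) \<union> (V - D))" by (rule mono) blast
    also have "\<dots> \<le> m (U - C) + m (V - D)" by (rule subadditive)
    also have "\<dots> < e" using 1 2 by simp
    finally show ?thesis using 1 2
      by (intro exI[of _ "C \<union> D"] exI[of _ "U \<union> V"]) auto
  qed
  moreover have "A \<union> B \<in> sets borel" using A B unfolding squeezed_sets_def by (intro sets.Un) simp_all
  ultimately show "A \<union> B \<in> squeezed_sets m" by (intro squeezed_setsI)
qed simp

text \<open>Replace each \<open>A i\<close> by a closed subset \<open>C i\<close> of nearly the same
  content. The \<open>C i\<close> have empty intersection, so by compactness finitely many of them
  already do. A late \<open>A k\<close> is then covered by finitely many of the pieces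
  \<open>A i - C i\<close> that were cut off.\<close>

lemma tendsto_squeezed_decseq:
  assumes A: "range A \<subseteq> squeezed_sets m" "decseq A" "(\<Inter>i. A i) = {}"
  shows "(\<lambda>i. m (A i)) \<longlonglongrightarrow> 0"
proof (rule LIMSEQ_I)
  fix e :: real assume e: "e > 0"
  \<comment> \<open>The errors \<open>e / 2 ^ (i + 2)\<close> add up to at most
    \<open>e / 2\<close>, however many indices compactness selects.\<close>
  have "\<exists>C. closed C \<and> C \<subseteq> A i \<and> m (A i - C) < e / 2 ^ (i + 2)" for i
  proof -
    obtain C U where "closed C" "open U" "C \<subseteq> A i" "A i \<subseteq> U" "m (U - C) < e / 2 ^ (i+2)"
    proof (rule squeezed_setsE)
      show "A i \<in> squeezed_sets m" using A(1) by auto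
      show "0 < e / 2 ^ (i+2)" using e by simp
    qed
    moreover have "m (A i - C) \<le> m (U - C)" using \<open>A i \<subseteq> U\<close> by (intro mono) auto
    ultimately show ?thesis by force
  qed
  then obtain C where C: "\<And>i. closed (C i)" "\<And>i. C i \<subseteq> A i" "\<And>i. m (A i - C i) < e / 2 ^ (i + 2)"
    by metis
  have "(\<Inter>i. C i) = {}" using A(3) C(2) by blast
  then obtain I where I: "finite I" "(\<Inter>i\<in>I. C i) = {}"
    using compact_imp_fip_image[OF compact_UNIV, of UNIV C] C(1) by auto
  obtain n where n: "I \<subseteq> {..<n}" using I(1) finite_nat_iff_bounded by blast
  have "norm (m (A k) - 0) < e" if "k \<ge> n" for k
  proof -
    have "A k \<subseteq> (\<Union>i<n. A i - C i)"
    proof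
      fix x assume x: "x \<in> A k"
      obtain i where "i \<in> I" "x \<notin> C i" using I(2) by blast
      moreover have "i \<le> k" using n that \<open>i \<in> I\<close> by force
      then have "x \<in> A i" using x decseqD[OF A(2)] by blast
      ultimately show "x \<in> (\<Union>i<n. A i - C i)" using n by blast
    qed
    then have "m (A k) \<le> m (\<Union>i<n. A i - C i)" by (rule mono)
    also have "\<dots> \<le> (\<Sum>i<n. m (A i - C i))" by (rule subadditive_UN) simp
    also have "\<dots> \<le> (\<Sum>i<n. e / 2 ^ (i + 2))" by (intro sum_mono less_imp_le C)
    also have "\<dots> = e / 4 * (\<Sum>i<n. (1/2) ^ i)"
      unfolding sum_distrib_left by (intro sum.cong) (auto simp: field_simps)
    also have "\<dots> = e / 4 * (2 - 2 * (1/2) ^ n)"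
      by (subst sum_gp_strict) (simp add: field_simps)
    also have "\<dots> \<le> e / 4 * 2" using e by (intro mult_left_mono) auto
    also have "\<dots> < e" using e by simp
    finally show ?thesis using nonneg[of "A k"] by simp
  qed
  then show "\<exists>no. \<forall>n\<ge>no. norm (m (A n) - 0) < e" by blast
qed

text \<open>The sublevel set is open and serves as its own \<open>U\<close>; a slightly lower closed
  sublevel set serves as \<open>C\<close>. Continuity of the distribution function at
  \<open>t\<close> ensures that little content lies between them.\<close>

lemma level_set_squeezed:
  fixes g :: "'a \<Rightarrow> real"
  assumes g: "continuous_on UNIV g" and t: "isCont (\<lambda>t. m {x. g x < t}) t"
  shows "{x. g x < t} \<in> squeezed_sets m"
proof -
  have op: "open {x. g x < t}" using open_Collect_less[OF g continuous_on_const] .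
  have "\<exists>C U. closed C \<and> open U \<and> C \<subseteq> {x. g x < t} \<and> {x. g x < t} \<subseteq> U \<and> m (U - C) < e"
    if e: "e > 0" for e
  proof -
    obtain d where d: "d > 0" "\<And>s. dist s t < d \<Longrightarrow> dist (m {x. g x < s}) (m {x. g x < t}) < e"
      using t[unfolded continuous_at_eps_delta, rule_format, OF e] by auto
    let ?s = "t - d/2"
    let ?C = "{x. g x \<le> ?s}"
    have C: "?C \<subseteq> {x. g x < t}" using d by auto
    have "m {x. g x < ?s} \<le> m ?C" by (intro mono) auto
    moreover have "dist (m {x. g x < ?s}) (m {x. g x < t}) < e"
      using d by (intro d(2)) (simp add: dist_real_def)
    ultimately have "m ({x. g x < t} - ?C) < e"
      unfolding diff[OF C] by (simp add: dist_real_def)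
    moreover have "closed ?C" using closed_Collect_le[OF g continuous_on_const] .
    ultimately show ?thesis using op C by blast
  qed
  moreover have "{x. g x < t} \<in> sets borel" using op by simp
  ultimately show ?thesis by (intro squeezed_setsI)
qed

text \<open>A monotone function has only countably many discontinuities, so every open interval
  contains a good level.\<close>

lemma level_set_squeezed_between:
  fixes g :: "'a \<Rightarrow> real"
  assumes g: "continuous_on UNIV g" and "a < b"
  obtains t where "a < t" "t < b" "{x. g x < t} \<in> squeezed_sets m"
proof -
  have "Fun.mono (\<lambda>t. m {x. g x < t})" by (intro monoI mono) auto
  then have "countable {t. \<not> isCont (\<lambda>t. m {x. g x < t}) t}" by (rule mono_ctble_discont)
  moreover have "uncountable {a<..<b}" using \<open>a < b\<close> by (simp add: uncountable_open_interval)
  ultimately have "\<not> {a<..<b} \<subseteq> {t. \<not> isCont (\<lambda>t. m {x. g x < t}) t}"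
    using countable_subset by metis
  then obtain t where "t \<in> {a<..<b}" "isCont (\<lambda>t. m {x. g x < t}) t"
    unfolding subset_iff mem_Collect_eq by metis
  then show thesis using that[of t] level_set_squeezed[OF g, of t] by simp
qed

text \<open>An open set is the union of the sets of points whose distance to its complement exceeds
  \<open>- t k\<close>. With good levels \<open>t k\<close> tending to 0, these are countably many
  squeezed sets.\<close>

lemma sigma_squeezed: "sigma_sets UNIV (squeezed_sets m) = sets borel"
proof
  show "sigma_sets UNIV (squeezed_sets m) \<subseteq> sets borel"
    using sets.sigma_sets_subset[of "squeezed_sets m" borel] by (auto simp: squeezed_sets_def)
  have "U \<in> sigma_sets UNIV (squeezed_sets m)" if U: "open U" for U
  \<comment> \<open>The whole space is treated apart because \<open>infdist\<close> to the empty set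
    is 0.\<close>
  proof (cases "U = UNIV")
    case False
    let ?g = "\<lambda>x. - infdist x (- U)"
    have g: "continuous_on UNIV ?g" by (intro continuous_intros)
    have "\<exists>t. - inverse (real (Suc k)) < t \<and> t < 0 \<and> {x. ?g x < t} \<in> squeezed_sets m" for k
      by (rule level_set_squeezed_between[OF g, of "- inverse (real (Suc k))" 0]) auto
    then obtain t where t: "\<And>k. - inverse (real (Suc k)) < t k" "\<And>k. t k < 0"
      "\<And>k. {x. ?g x < t k} \<in> squeezed_sets m" by metis
    have "U = (\<Union>k. {x. ?g x < t k})"
    proof (intro set_eqI iffI)
      fix x assume "x \<in> U"
      then have "infdist x (- U) \<noteq> 0"
        using in_closed_iff_infdist_zero[of "- U" x] U False by auto
      then have "infdist x (- U) > 0" using infdist_nonneg[of x "- U"] by linarith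
      then obtain k where "inverse (real (Suc k)) < infdist x (- U)"
        using reals_Archimedean by blast
      then show "x \<in> (\<Union>k. {x. ?g x < t k})" using t(1)[of k] by (intro UN_I[of k] CollectI) auto
    next
      fix x assume "x \<in> (\<Union>k. {x. ?g x < t k})"
      then obtain k where "- infdist x (- U) < t k" by blast
      then have "infdist x (- U) > 0" using t(2)[of k] by linarith
      then show "x \<in> U" using infdist_zero[of x "- U"] by (cases "x \<in> U") auto
    qed
    moreover have "(\<Union>k. {x. ?g x < t k}) \<in> sigma_sets UNIV (squeezed_sets m)"
      by (intro sigma_sets.Union sigma_sets.Basic t(3))
    ultimately show ?thesis by simp
  qed (simp add: sigma_sets_top)
  then show "sets borel \<subseteq> sigma_sets UNIV (squeezed_sets m)"
    unfolding borel_def by (auto intro!: sigma_sets_mono)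
qed

text \<open>Continuity at the empty set is what Caratheodory's theorem asks of a content on an
  algebra. The extension need not agree with \<open>m\<close> on other Borel sets: if an orbit tends
  to a point outside it, the limiting content of the orbit is 1, while its measure is 0.\<close>

lemma ex_measure:
  obtains M where "prob_space M" "sets M = sets borel"
    "\<And>A. A \<in> squeezed_sets m \<Longrightarrow> measure M A = m A"
proof -
  interpret algebra UNIV "squeezed_sets m" by (rule algebra_squeezed)
  have "\<exists>\<mu> :: 'a set \<Rightarrow> ennreal. (\<forall>s \<in> squeezed_sets m. \<mu> s = ennreal (m s)) \<and>
      measure_space UNIV (sigma_sets UNIV (squeezed_sets m)) \<mu>"
  proof (rule caratheodory_empty_continuous)
    show "positive (squeezed_sets m) (\<lambda>A. ennreal (m A))"
      by (simp add: positive_def empty)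
    show "Measure_Space.additive (squeezed_sets m) (\<lambda>A. ennreal (m A))"
      by (auto simp: Measure_Space.additive_def additive nonneg ennreal_plus)
    show "(\<lambda>i. ennreal (m (A i))) \<longlonglongrightarrow> 0"
      if "range A \<subseteq> squeezed_sets m" "decseq A" "(\<Inter>i. A i) = {}" for A
      using tendsto_ennrealI[OF tendsto_squeezed_decseq[OF that]] by simp
  qed simp
  then obtain \<mu> where \<mu>: "\<And>s. s \<in> squeezed_sets m \<Longrightarrow> \<mu> s = ennreal (m s)"
      "measure_space UNIV (sets borel) \<mu>" unfolding sigma_squeezed by blast
  define M where "M = measure_of UNIV (sets (borel :: 'a measure)) \<mu>"
  have sets: "sets M = sets borel" unfolding M_def
    by (metis sets.sets_measure_of_eq space_borel)
  have em: "emeasure M A = \<mu> A" if "A \<in> sets borel" for A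
    using \<mu>(2) that unfolding M_def measure_space_def
    by (intro emeasure_measure_of_sigma) auto
  have sq: "emeasure M A = ennreal (m A)" if "A \<in> squeezed_sets m" for A
    using em[of A] \<mu>(1)[OF that] that by (simp add: squeezed_sets_def)
  have "UNIV \<in> squeezed_sets m" by (rule top)
  then have "emeasure M UNIV = 1" using sq[of UNIV] total by simp
  moreover have "space M = UNIV" using sets_eq_imp_space_eq[OF sets] by simp
  ultimately have "prob_space M" by (intro prob_spaceI) simp
  moreover have "measure M A = m A" if "A \<in> squeezed_sets m" for A
    using sq[OF that] nonneg[of A] by (simp add: measure_def)
  ultimately show thesis using that sets by blast
qed

end

section \<open>Birkhoff averages of uniquely ergodic maps\<close>
context fin_content
begin

text \<open>Slice the range of \<open>g + B\<close> into layers of height \<open>e\<close> and put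
  one good threshold \<open>t i\<close> strictly inside each. If \<open>g x + B\<close> lies in
  layer \<open>j\<close>, then \<open>j\<close> or \<open>j + 1\<close> thresholds do not exceed it,
  so counting thresholds recovers \<open>g x\<close> up to \<open>e\<close>. Squeezed sets are used
  because content and measure agree on them.\<close>

lemma step_approximation:
  fixes g :: "'a \<Rightarrow> real"
  assumes g: "continuous_on UNIV g" and e: "e > 0"
  obtains c n A where "\<And>i. A i \<in> squeezed_sets m"
    "\<And>x. \<bar>g x - (c + (\<Sum>i<n::nat. e * indicator (A i) x))\<bar> \<le> e"
proof -
  interpret algebra UNIV "squeezed_sets m" by (rule algebra_squeezed)
  have "bounded (range g)"
    using compact_continuous_image[OF g compact_UNIV] by (rule compact_imp_bounded)
  then obtain B where B: "\<And>x. \<bar>g x\<bar> \<le> B" unfolding bounded_iff by auto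
  have "\<exists>t. e * real i < t \<and> t < e * real (Suc i) \<and> {x. g x + B < t} \<in> squeezed_sets m" for i
  proof (rule level_set_squeezed_between)
    show "continuous_on UNIV (\<lambda>x. g x + B)" by (intro continuous_intros g)
    show "e * real i < e * real (Suc i)" using e by simp
  qed blast
  then obtain t where t: "\<And>i. e * real i < t i" "\<And>i. t i < e * real (Suc i)"
    "\<And>i. {x. g x + B < t i} \<in> squeezed_sets m" by metis
  define A where "A i = UNIV - {x. g x + B < t i}" for i
  have A: "A i \<in> squeezed_sets m" for i unfolding A_def by (rule compl_sets[OF t(3)])
  \<comment> \<open>\<open>g + B\<close> takes values in \<open>[0, 2 * B]\<close>, so
    \<open>n\<close> layers cover its range.\<close>
  obtain n where n: "2 * B / e < real n" using reals_Archimedean2 by blast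
  have "\<bar>g x - (- B + (\<Sum>i<n. e * indicator (A i) x))\<bar> \<le> e" for x
  proof -
    define j where "j = nat \<lfloor>(g x + B) / e\<rfloor>"
    let ?I = "{i\<in>{..<n}. x \<in> A i}"
    have "0 \<le> g x + B" using B[of x] by linarith
    then have j: "real j \<le> (g x + B) / e" "(g x + B) / e < real j + 1"
      unfolding j_def using e by (auto simp: of_nat_nat intro: of_int_floor_le)
    have je: "e * real j \<le> g x + B" "g x + B < e * (real j + 1)"
      using j e by (simp_all add: field_simps)
    have "(g x + B) / e \<le> 2 * B / e" using B[of x] e by (intro divide_right_mono) auto
    then have "real j < real n" using j n by linarith
    then have "j < n" by simp
    have "{..<j} \<subseteq> ?I"
    proof
      fix i assume "i \<in> {..<j}"
      then have "e * real (Suc i) \<le> e * real j" using e by (intro mult_left_mono) auto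
      then have "t i \<le> g x + B" using t(2)[of i] je by linarith
      then show "i \<in> ?I" using \<open>i \<in> {..<j}\<close> \<open>j < n\<close> by (simp add: A_def)
    qed
    then have "j \<le> card ?I" using card_mono[of ?I "{..<j}"] by simp
    moreover have "?I \<subseteq> {..<Suc j}"
    proof
      fix i assume "i \<in> ?I"
      then have "t i \<le> g x + B" by (simp add: A_def)
      then have "e * real i < e * (real j + 1)" using t(1)[of i] je by linarith
      then have "real i < real j + 1" using e by simp
      then show "i \<in> {..<Suc j}" by simp
    qed
    then have "card ?I \<le> Suc j" using card_mono[of "{..<Suc j}" ?I] by simp
    ultimately have "e * real j \<le> e * real (card ?I)" "e * real (card ?I) \<le> e * real (Suc j)"
      using e by (intro mult_left_mono; simp del: of_nat_Suc)+
    moreover have "(\<Sum>i<n. e * indicator (A i) x) = e * real (card ?I)"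
      by (simp add: sum_distrib_left[symmetric] indicator_def sum.If_cases Int_def)
    moreover have "e * real (Suc j) = e * real j + e" "e * (real j + 1) = e * real j + e"
      by (simp_all add: algebra_simps)
    ultimately show ?thesis using je by linarith
  qed
  then show thesis using that[of A "- B" n] A by blast
qed

end

section \<open>Invariance of limiting averages\<close>

lemma birkhoff_avg_bound_diff:
  assumes "\<And>x. \<bar>g x - h x\<bar> \<le> e"
  shows "\<bar>birkhoff_avg r g \<theta> K - birkhoff_avg r h \<theta> K\<bar> \<le> e"
  using birkhoff_avg_abs_le[of "\<lambda>x. g x - h x" e r \<theta> K] assms
  by (simp add: birkhoff_avg_diff)

lemma birkhoff_avg_const: "K > 0 \<Longrightarrow> birkhoff_avg r (\<lambda>_. c) \<theta> K = c"
  by (simp add: birkhoff_avg_def)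

text \<open>The source of invariance: the two sums differ only in their end terms.\<close>

lemma birkhoff_avg_shift:
  assumes "\<And>x. \<bar>g x\<bar> \<le> B"
  shows "\<bar>birkhoff_avg r (\<lambda>x. g (r x)) \<theta> K - birkhoff_avg r g \<theta> K\<bar> \<le> 2 * B / real K"
proof -
  have "(\<Sum>i<K. g (r ((r ^^ i) \<theta>))) - (\<Sum>i<K. g ((r ^^ i) \<theta>)) = g ((r ^^ K) \<theta>) - g \<theta>"
    using sum_lessThan_telescope[of "\<lambda>i. g ((r ^^ i) \<theta>)" K] by (simp add: sum_subtractf)
  moreover have "\<bar>g ((r ^^ K) \<theta>) - g \<theta>\<bar> \<le> 2 * B"
    using assms[of "(r ^^ K) \<theta>"] assms[of \<theta>] by linarith
  ultimately show ?thesis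
    by (simp add: birkhoff_avg_def diff_divide_distrib[symmetric] divide_right_mono)
qed

lemma fin_content_birkhoff_limit:
  fixes r :: "'a::metric_space \<Rightarrow> 'a"
  assumes "compact (UNIV :: 'a set)" and G: "G \<le> sequentially" "G \<noteq> bot"
    and m: "\<And>A. (birkhoff_avg r (indicator A) \<theta> \<longlongrightarrow> m A) G"
  shows "fin_content m" and "m (r -` A) = m A"
proof -
  \<comment> \<open>At \<open>K = 0\<close> the average of the constant 1 is 0, because division by
    zero gives 0; total mass 1 therefore needs positive \<open>K\<close>.\<close>
  have pos: "eventually (\<lambda>K. K > 0) G"
    using filter_leD[OF G(1)] eventually_gt_at_top by blast
  show "fin_content m"
  proof
    show "0 \<le> m A" for A
      by (rule tendsto_lowerbound[OF m _ G(2)])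
        (simp add: birkhoff_avg_def sum_nonneg always_eventually)
    have "eventually (\<lambda>K. birkhoff_avg r (indicator UNIV) \<theta> K = 1) G"
      using pos by eventually_elim (simp add: birkhoff_avg_def)
    then have "(birkhoff_avg r (indicator UNIV) \<theta> \<longlongrightarrow> 1) G" by (rule tendsto_eventually)
    then show "m UNIV = 1" using tendsto_unique[OF G(2) m] by blast
    show "m (A \<union> B) = m A + m B" if "A \<inter> B = {}" for A B
    proof -
      have eq: "indicator (A \<union> B) = (\<lambda>x. indicator A x + indicator B x :: real)"
        using that by (auto simp: indicator_def fun_eq_iff)
      then have "birkhoff_avg r (indicator (A \<union> B)) \<theta>
          = (\<lambda>K. birkhoff_avg r (indicator A) \<theta> K + birkhoff_avg r (indicator B) \<theta> K)"
        unfolding eq by (intro ext birkhoff_avg_add)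
      then show ?thesis
        using tendsto_unique[OF G(2) m[of "A \<union> B"]] tendsto_add[OF m[of A] m[of B]] by metis
    qed
  qed (rule assms)
  have "((\<lambda>K. 2 * 1 / real K) \<longlongrightarrow> 0) G"
    by (rule tendsto_mono[OF G(1)]) real_asymp
  then have "((\<lambda>K. birkhoff_avg r (\<lambda>x. indicator A (r x)) \<theta> K - birkhoff_avg r (indicator A) \<theta> K) \<longlongrightarrow> 0) G"
  proof (rule Lim_null_comparison[rotated])
    have "\<bar>indicator A x :: real\<bar> \<le> 1" for x by (simp add: indicator_def)
    then show "eventually (\<lambda>K. norm (birkhoff_avg r (\<lambda>x. indicator A (r x)) \<theta> K
        - birkhoff_avg r (indicator A) \<theta> K) \<le> 2 * 1 / real K) G"
      unfolding real_norm_def by (intro always_eventually allI birkhoff_avg_shift)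
  qed
  moreover have "(\<lambda>x. indicator A (r x) :: real) = indicator (r -` A)" by (auto simp: indicator_def)
  ultimately have "((\<lambda>K. birkhoff_avg r (indicator (r -` A)) \<theta> K - birkhoff_avg r (indicator A) \<theta> K) \<longlongrightarrow> 0) G"
    by simp
  then have "m (r -` A) - m A = 0"
    using tendsto_unique[OF G(2) tendsto_diff[OF m m]] by blast
  then show "m (r -` A) = m A" by simp
qed

text \<open>The starting filter \<open>G0\<close> is arbitrary, and this freedom is the point: it
  may be supported on times at which the averages misbehave, and the measure found there is still
  invariant.\<close>

lemma krylov_bogolyubov:
  fixes r :: "'a::metric_space \<Rightarrow> 'a"
  assumes comp: "compact (UNIV :: 'a set)" and r: "continuous_on UNIV r"
    and G0: "G0 \<le> sequentially" "G0 \<noteq> bot"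
  obtains G M where "G \<le> G0" "G \<noteq> bot" "invariant_prob r M"
    "\<And>g. continuous_on UNIV g \<Longrightarrow> (birkhoff_avg r g \<theta> \<longlongrightarrow> integral\<^sup>L M g) G"
proof -
  obtain G m where G: "G \<le> G0" "G \<noteq> bot"
    and m: "\<And>A. (birkhoff_avg r (indicator A) \<theta> \<longlongrightarrow> m A) G"
    using birkhoff_avg_cluster[OF G0(2), of r \<theta>] by blast
  have G': "G \<le> sequentially" using G(1) G0(1) by (rule order_trans)
  interpret fin_content m by (rule fin_content_birkhoff_limit[OF comp G' G(2) m])
  interpret algebra UNIV "squeezed_sets m" by (rule algebra_squeezed)
  note inv = fin_content_birkhoff_limit(2)[OF comp G' G(2) m]
  obtain M where M: "prob_space M" "sets M = sets borel"
    "\<And>A. A \<in> squeezed_sets m \<Longrightarrow> measure M A = m A" by (rule ex_measure) blast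
  interpret M: prob_space M by (rule M(1))
  have space: "space M = UNIV" using sets_eq_imp_space_eq[OF M(2)] by simp
  have borel_r: "r \<in> borel_measurable borel" using r by (rule borel_measurable_continuous_onI)
  have meas: "h \<in> borel_measurable M" if "h \<in> borel_measurable borel" for h :: "'a \<Rightarrow> 'b::topological_space"
    using that M(2) by (simp cong: measurable_cong_sets)
  have pre_r: "emeasure (distr M borel r) X = emeasure M (r -` X)" if "X \<in> sets borel" for X
    using that meas[OF borel_r] by (simp add: emeasure_distr space)
  have "distr M borel r = M"
  proof (rule measure_eqI_generator_eq[where E="squeezed_sets m" and \<Omega>=UNIV and A="\<lambda>_. UNIV"])
    show "Int_stable (squeezed_sets m)" by (auto simp: Int_stable_def)
    show "emeasure (distr M borel r) X = emeasure M X" if X: "X \<in> squeezed_sets m" for X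
    proof -
      have Xb: "X \<in> sets borel" using X by (simp add: squeezed_sets_def)
      \<comment> \<open>\<open>M\<close> and \<open>m\<close> agree only on squeezed sets, so
        invariance of \<open>m\<close> helps only if the preimage of \<open>X\<close> is squeezed as
        well. Continuity of \<open>r\<close> pulls back \<open>C\<close> and \<open>U\<close>, and
        invariance of \<open>m\<close> keeps their gap small.\<close>
      have pre: "r -` X \<in> squeezed_sets m"
      proof (rule squeezed_setsI)
        show "r -` X \<in> sets borel" using measurable_sets[OF borel_r Xb] by simp
        fix e :: real assume "e > 0"
        then obtain C U where CU: "closed C" "open U" "C \<subseteq> X" "X \<subseteq> U" "m (U - C) < e"
          using squeezed_setsE[OF X] by blast
        have "closed (r -` C)" using CU(1) r by (rule closed_vimage)
        moreover have "open (r -` U)" using CU(2) r by (rule open_vimage)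
        moreover have "m (r -` U - r -` C) < e" using CU(5) inv[of "U - C"] by (simp add: vimage_Diff)
        ultimately show "\<exists>C U. closed C \<and> open U \<and> C \<subseteq> r -` X \<and> r -` X \<subseteq> U \<and> m (U - C) < e"
          using CU(3,4) by (intro exI[of _ "r -` C"] exI[of _ "r -` U"]) auto
      qed
      have "emeasure (distr M borel r) X = emeasure M (r -` X)"
        by (rule pre_r[OF Xb])
      also have "\<dots> = emeasure M X"
        using M(3)[OF X] M(3)[OF pre] inv[of X] by (simp add: M.emeasure_eq_measure)
      finally show ?thesis .
    qed
  qed (use M(2) sigma_squeezed in \<open>auto simp: pre_r M.emeasure_eq_measure\<close>)
  then have "invariant_prob r M" using M by (simp add: invariant_prob_def)
  moreover have "(birkhoff_avg r g \<theta> \<longlongrightarrow> integral\<^sup>L M g) G" if g: "continuous_on UNIV g" for g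
  proof (rule tendstoI)
    fix e' :: real assume "e' > 0"
    \<comment> \<open>Three errors of size \<open>e\<close>: approximating \<open>g\<close> under
      the averages, approximating it under the integral, and the convergence of the averages of the
      step function.\<close>
    define e where "e = e' / 3"
    have e: "e > 0" using \<open>e' > 0\<close> by (simp add: e_def)
    obtain c n A where A: "\<And>i. A i \<in> squeezed_sets m"
      and approx: "\<And>x. \<bar>g x - (c + (\<Sum>i<n::nat. e * indicator (A i) x))\<bar> \<le> e"
      by (rule step_approximation[OF g e]) (rule that)
    have Ab: "A i \<in> sets M" for i using A[of i] M(2) by (simp add: squeezed_sets_def)
    let ?s = "\<lambda>x. c + (\<Sum>i<n. e * indicator (A i) x)"
    let ?S = "c + (\<Sum>i<n. e * m (A i))"
    have int_A: "integrable M (\<lambda>x. e * indicator (A i) x)" for i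
      using Ab by (intro integrable_mult_right integrable_real_indicator)
        (auto simp: M.emeasure_eq_measure)
    have int_s: "integrable M ?s"
      by (intro Bochner_Integration.integrable_add Bochner_Integration.integrable_sum int_A) simp
    have "bounded (range g)"
      using compact_continuous_image[OF g comp] by (rule compact_imp_bounded)
    then obtain B where B: "\<And>x. \<bar>g x\<bar> \<le> B" unfolding bounded_iff by auto
    have int_g: "integrable M g"
      by (rule M.integrable_const_bound[of _ B])
        (use B meas[OF borel_measurable_continuous_onI[OF g]] in auto)
    have int_sum: "integrable M (\<lambda>x. \<Sum>i<n. e * indicator (A i) x)"
      by (intro Bochner_Integration.integrable_sum int_A)
    have "integral\<^sup>L M ?s = integral\<^sup>L M (\<lambda>_. c)
        + integral\<^sup>L M (\<lambda>x. \<Sum>i<n. e * indicator (A i) x)"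
      by (rule Bochner_Integration.integral_add[OF M.integrable_const int_sum])
    also have "integral\<^sup>L M (\<lambda>x. \<Sum>i<n. e * indicator (A i) x)
        = (\<Sum>i<n. integral\<^sup>L M (\<lambda>x. e * indicator (A i) x))"
      by (rule Bochner_Integration.integral_sum[OF int_A])
    also have "integral\<^sup>L M (\<lambda>_. c) + \<dots> = ?S"
      using Ab M(3)[OF A] M.prob_space by (simp add: space)
    finally have "integral\<^sup>L M ?s = ?S" .
    moreover have "\<bar>integral\<^sup>L M g - integral\<^sup>L M ?s\<bar> \<le> e"
    proof -
      have "\<bar>integral\<^sup>L M (\<lambda>x. g x - ?s x)\<bar> \<le> integral\<^sup>L M (\<lambda>x. e)"
        by (rule order_trans[OF integral_abs_bound integral_mono])
          (use int_g int_s approx in auto)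
      then show ?thesis using int_g int_s M.prob_space by simp
    qed
    ultimately have 1: "\<bar>integral\<^sup>L M g - ?S\<bar> \<le> e" by simp
    have "((\<lambda>K. c + (\<Sum>i<n. e * birkhoff_avg r (indicator (A i)) \<theta> K)) \<longlongrightarrow> ?S) G"
      by (intro tendsto_intros m)
    then have "eventually (\<lambda>K. dist (c + (\<Sum>i<n. e * birkhoff_avg r (indicator (A i)) \<theta> K)) ?S < e) G"
      using e by (rule tendstoD)
    moreover have "eventually (\<lambda>K. K > 0) G"
      using filter_leD[OF G'] eventually_gt_at_top by blast
    ultimately show "eventually (\<lambda>K. dist (birkhoff_avg r g \<theta> K) (integral\<^sup>L M g) < e') G"
    proof eventually_elim
      case (elim K)
      have "birkhoff_avg r ?s \<theta> K = c + (\<Sum>i<n. e * birkhoff_avg r (indicator (A i)) \<theta> K)"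
        using elim(2) by (subst birkhoff_avg_add, subst birkhoff_avg_sum_mult)
          (simp add: birkhoff_avg_const)
      then show ?case
        using elim(1) 1 birkhoff_avg_bound_diff[of g ?s, OF approx, of r \<theta> K]
        unfolding dist_real_def e_def by linarith
    qed
  qed
  ultimately show thesis using that G by blast
qed

text \<open>Apply the preceding construction along the times at which the average at \<theta> stays
  away from the integral. Uniqueness identifies the resulting measure with \<mu>, so the averages
  approach the integral along these times after all.\<close>

lemma uniquely_ergodic_birkhoff:
  fixes r :: "'a::metric_space \<Rightarrow> 'a" and g :: "'a \<Rightarrow> real"
  assumes comp: "compact (UNIV :: 'a set)" and r: "continuous_on UNIV r"
    and ue: "uniquely_ergodic r" and g: "continuous_on UNIV g"
  obtains c where "\<And>\<theta>. birkhoff_avg r g \<theta> \<longlonglongrightarrow> c"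
proof -
  obtain \<mu> where \<mu>: "\<And>M. invariant_prob r M \<Longrightarrow> M = \<mu>"
    using ue unfolding uniquely_ergodic_def by blast
  have "birkhoff_avg r g \<theta> \<longlonglongrightarrow> integral\<^sup>L \<mu> g" for \<theta>
  proof (rule tendstoI, rule ccontr)
    fix e :: real assume "e > 0"
    let ?P = "\<lambda>K. dist (birkhoff_avg r g \<theta> K) (integral\<^sup>L \<mu> g) < e"
    assume "\<not> eventually ?P sequentially"
    then have fr: "inf sequentially (principal {K. \<not> ?P K}) \<noteq> bot" (is "?G \<noteq> bot")
      unfolding trivial_limit_def eventually_inf_principal by simp
    obtain G M where G: "G \<le> ?G" "G \<noteq> bot" "invariant_prob r M"
      "\<And>g. continuous_on UNIV g \<Longrightarrow> (birkhoff_avg r g \<theta> \<longlongrightarrow> integral\<^sup>L M g) G"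
      using krylov_bogolyubov[OF comp r inf_le1 fr] by blast
    have "eventually ?P G" using G(4)[OF g] \<mu>[OF G(3)] \<open>e > 0\<close> by (auto dest: tendstoD)
    moreover have "eventually (\<lambda>K. \<not> ?P K) G"
      by (rule filter_leD[OF G(1)]) (simp add: eventually_inf_principal)
    ultimately have "eventually (\<lambda>_. False) G" by eventually_elim simp
    then show False using G(2) by (simp add: trivial_limit_def)
  qed
  then show thesis using that by blast
qed

section \<open>Degree one\<close>
lemma continuous_on_circle_proj [continuous_intros]:
  assumes "continuous_on S g"
  shows "continuous_on S (\<lambda>x. circle_proj (g x))"
proof -
  have "continuous_on UNIV circle_proj"
    by (rule lipschitz_on_continuous_on[of 1])
      (use dist_circle_proj_le in \<open>auto intro!: lipschitz_onI simp: dist_commute\<close>)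
  then show ?thesis by (rule continuous_on_compose2[OF _ assms]) simp
qed

lemma circle_proj_add_int: "circle_proj (x + of_int k) = circle_proj x"
  by (simp add: circle_proj_eq_iff)

lemma circle_dist_obtains_int:
  obtains k :: int where "dist (circle_proj x) (circle_proj y) = \<bar>x - y - of_int k\<bar>"
  unfolding dist_circle_proj INF_int_shift_eq_round by blast

text \<open>The embedding of the circle as the unit circle of the complex plane, which makes winding
  numbers available as degrees.\<close>

lift_definition circle_exp :: "circle \<Rightarrow> complex" is "\<lambda>x. exp (2 * of_real pi * \<i> * of_real x)"
proof -
  fix x y :: real assume "x - y \<in> \<int>"
  then obtain k :: int where "x - y = of_int k" by (elim Ints_cases)
  then have "x = y + of_int k" by linarith
  then have "2 * of_real pi * \<i> * of_real x = 2 * of_real pi * \<i> * of_real y + of_real (of_int (2 * k) * pi) * \<i>"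
    by (simp add: algebra_simps)
  then show "exp (2 * of_real pi * \<i> * of_real x) = exp (2 * of_real pi * \<i> * of_real y)"
    unfolding exp_eq by blast
qed

lemma circle_exp_proj: "circle_exp (circle_proj x) = exp (2 * of_real pi * \<i> * of_real x)"
  by transfer simp

lemma circle_exp_nonzero: "circle_exp c \<noteq> 0"
  by transfer simp

lemma continuous_on_circle_exp: "continuous_on UNIV circle_exp"
  unfolding continuous_on_open_vimage[OF open_UNIV]
proof (intro allI impI)
  fix B :: "complex set" assume "open B"
  have "circle_proj -` (circle_exp -` B) = (\<lambda>x. exp (2 * of_real pi * \<i> * of_real x)) -` B"
    by (auto simp: circle_exp_proj)
  also have "open \<dots>" by (intro open_vimage \<open>open B\<close> continuous_intros)
  finally show "open (circle_exp -` B \<inter> UNIV)" by (simp add: open_circle_iff)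
qed

text \<open>Up to the factor 2 pi i, \<open>p\<close> is a continuous logarithm of the path, so the
  winding number is its increment.\<close>

lemma winding_number_circle_exp:
  assumes "continuous_on {0..1} p"
  shows "winding_number (\<lambda>t. circle_exp (circle_proj (p t))) 0 = of_real (p 1 - p 0)"
proof -
  let ?q = "\<lambda>t. 2 * of_real pi * \<i> * of_real (p t) :: complex"
  have "path ?q" unfolding path_def by (intro continuous_intros assms)
  then have "winding_number (exp \<circ> ?q) 0 = (?q 1 - ?q 0) / (2 * of_real pi * \<i>)"
    using winding_number_compose_exp[of ?q] by (simp add: pathfinish_def pathstart_def)
  moreover have "(exp \<circ> ?q) = (\<lambda>t. circle_exp (circle_proj (p t)))"
    by (simp add: fun_eq_iff circle_exp_proj)
  moreover have "(?q 1 - ?q 0) / (2 * of_real pi * \<i>) = of_real (p 1 - p 0)"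
  proof -
    have "?q 1 - ?q 0 = (2 * of_real pi * \<i>) * of_real (p 1 - p 0)" by (simp add: algebra_simps)
    moreover have "2 * of_real pi * \<i> \<noteq> (0 :: complex)" by simp
    ultimately show ?thesis by (metis nonzero_mult_div_cancel_left)
  qed
  ultimately show ?thesis by simp
qed

text \<open>The homotopy may move points across fibres. Its circle coordinate along the circle over
  \<theta> is still a free homotopy of loops from the fibre map to the identity, and winding numbers
  see nothing else.\<close>

lemma fibre_map_degree_one:
  fixes r :: "'a::metric_space \<Rightarrow> 'a"
  assumes f: "homotopic_to_identity r f" and F: "continuous_lift r f F"
  shows "fibre_map F \<theta> (x + of_int k) = fibre_map F \<theta> x + of_int k"
proof -
  have F_cont: "continuous_on UNIV F" using F by (simp add: continuous_lift_def)
  have contF: "continuous_on UNIV (fibre_map F \<theta>)" for \<theta>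
    unfolding fibre_map_def
    by (intro continuous_intros continuous_on_compose2[OF F_cont]) auto
  have lift: "snd (f (\<theta>, circle_proj x)) = circle_proj (fibre_map F \<theta> x)" for \<theta> x
  proof -
    have "snd ((f \<circ> cover_proj) (\<theta>, x)) = snd ((cover_proj \<circ> F) (\<theta>, x))"
      using F unfolding continuous_lift_def by simp
    then show ?thesis by (simp add: cover_proj_def fibre_map_def case_prod_unfold)
  qed
  have int: "fibre_map F \<theta> (x + 1) - fibre_map F \<theta> x \<in> \<int>" for x
    unfolding circle_proj_eq_iff[symmetric] lift[symmetric]
    using circle_proj_add_int[of x 1] by simp
  obtain h where h: "continuous_on ({0..1::real} \<times> UNIV) h"
    "\<And>p. h (0, p) = f p" "\<And>p. h (1, p) = (case p of (\<theta>, \<phi>) \<Rightarrow> (r \<theta>, \<phi>))"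
    using f unfolding homotopic_to_identity_def homotopic_with_def prod_topology_subtopology_eu
      continuous_map_iff_continuous by auto
  let ?H = "\<lambda>(s, t). circle_exp (snd (h (s, \<theta>, circle_proj t)))"
  have "homotopic_loops (- {0}) (\<lambda>t. circle_exp (circle_proj (fibre_map F \<theta> t)))
      (\<lambda>t. circle_exp (circle_proj t))"
    unfolding homotopic_loops
  proof (intro exI[of _ ?H] conjI ballI)
    show "continuous_on ({0..1} \<times> {0..1}) ?H"
      unfolding case_prod_unfold
      by (intro continuous_on_compose2[OF continuous_on_circle_exp]
          continuous_on_compose2[OF h(1)] continuous_intros) auto
    show "?H \<in> {0..1} \<times> {0..1} \<rightarrow> - {0}" by (auto simp: circle_exp_nonzero)
    show "pathfinish (?H \<circ> Pair t) = pathstart (?H \<circ> Pair t)" for t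
      using circle_proj_add_int[of 0 1] by (simp add: pathfinish_def pathstart_def)
  qed (auto simp: h lift)
  then have "winding_number (\<lambda>t. circle_exp (circle_proj (fibre_map F \<theta> t))) 0
      = winding_number (\<lambda>t. circle_exp (circle_proj t)) 0"
    by (rule winding_number_homotopic_loops)
  moreover have "continuous_on {0..1} (fibre_map F \<theta>)"
    using contF continuous_on_subset by blast
  ultimately have "of_real (fibre_map F \<theta> 1 - fibre_map F \<theta> 0) = (of_real (1 - 0) :: complex)"
    using winding_number_circle_exp[of "fibre_map F \<theta>"] winding_number_circle_exp[of "\<lambda>t. t"]
    by simp
  then have deg: "fibre_map F \<theta> 1 - fibre_map F \<theta> 0 = 1" by (simp only: of_real_eq_iff)
  \<comment> \<open>The increment over a unit step is continuous and integer-valued, hence constant,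
    so its value at 0 decides.\<close>
  let ?D = "\<lambda>x. fibre_map F \<theta> (x + 1) - fibre_map F \<theta> x"
  have "continuous_on UNIV ?D"
    by (intro continuous_intros contF continuous_on_compose2[OF contF]) auto
  then have "?D constant_on UNIV"
  proof (rule continuous_discrete_range_constant[OF connected_UNIV])
    fix x :: real
    have "1 \<le> norm (?D y - ?D x)" if "?D y \<noteq> ?D x" for y
      using Ints_nonzero_abs_ge1[OF Ints_diff[OF int[of y] int[of x]]] that by simp
    then show "\<exists>e>0. \<forall>y. y \<in> UNIV \<and> ?D y \<noteq> ?D x \<longrightarrow> e \<le> norm (?D y - ?D x)"
      by (intro exI[of _ 1]) simp
  qed
  then obtain c where c: "\<And>x. ?D x = c" unfolding constant_on_def by blast
  have step: "fibre_map F \<theta> (x + 1) = fibre_map F \<theta> x + 1" for x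
    using deg c[of 0] c[of x] by simp
  have nat: "fibre_map F \<theta> (x + real n) = fibre_map F \<theta> x + real n" for x n
  proof (induction n)
    case (Suc n)
    then show ?case using step[of "x + real n"] by (simp add: add.commute add.left_commute)
  qed simp
  show ?thesis
  proof (cases k rule: int_cases2)
    case (nonneg n)
    then show ?thesis using nat[of x n] by simp
  next
    case (nonpos n)
    then show ?thesis using nat[of "x - real n" n] by simp
  qed
qed

section \<open>Displacements and rotation numbers\<close>
text \<open>Both sides are the sum of all increments \<open>z (i + j + 1) - z (i + j)\<close> with
  \<open>i < K\<close> and \<open>j < n\<close>, taken in the two possible orders.\<close>

lemma shift_sum_telescope:
  fixes z :: "nat \<Rightarrow> real"
  shows "(\<Sum>i<K. z (i + n) - z i) = (\<Sum>j<n. z (K + j) - z j)"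
proof (induction K)
  case (Suc K)
  have "(\<Sum>j<n. z (Suc K + j)) - (\<Sum>j<n. z (K + j)) = z (K + n) - z K"
    using sum_lessThan_telescope[of "\<lambda>j. z (K + j)" n] by (simp add: sum_subtractf)
  then show ?case using Suc by (simp add: sum_subtractf)
qed simp

text \<open>After the exchange there are only \<open>n\<close> terms, each within
  \<open>2 * real n * C\<close> of \<open>z K - z 0\<close>, so the error does not grow with
  \<open>K\<close>.\<close>

lemma sum_shift_diff_lower_bound:
  fixes z :: "nat \<Rightarrow> real"
  assumes C: "\<And>i. \<bar>z (Suc i) - z i\<bar> \<le> C"
  shows "real n * (z K - z 0) - 2 * real n * real n * C \<le> (\<Sum>i<K. z (i + n) - z i)"
proof -
  have C0: "0 \<le> C" using C[of 0] by linarith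
  have *: "\<bar>z (i + j) - z i\<bar> \<le> real j * C" for i j
  proof (induction j)
    case (Suc j)
    then show ?case using C[of "i + j"] by (simp add: algebra_simps)
  qed simp
  have "(\<Sum>j<n. z K - z 0 - 2 * real n * C) \<le> (\<Sum>j<n. z (K + j) - z j)"
  proof (rule sum_mono)
    fix j assume "j \<in> {..<n}"
    then have "real j * C \<le> real n * C" using C0 by (intro mult_right_mono) auto
    then show "z K - z 0 - 2 * real n * C \<le> z (K + j) - z j"
      using *[of K j] *[of 0 j] by simp
  qed
  then show ?thesis by (subst shift_sum_telescope) (simp add: algebra_simps)
qed

section \<open>Extrema over a fundamental domain\<close>

lemma SUP_unit_interval_attained:
  fixes h :: "real \<Rightarrow> real"
  assumes "continuous_on {0..1} h"
  obtains x where "x \<in> {0..1}" "(SUP x\<in>{0..1}. h x) = h x" "\<And>y. y \<in> {0..1} \<Longrightarrow> h y \<le> h x"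
proof -
  obtain x where x: "x \<in> {0..1}" "\<And>y. y \<in> {0..1} \<Longrightarrow> h y \<le> h x"
    using continuous_attains_sup[OF compact_Icc _ assms] by auto
  then have "(SUP x\<in>{0..1}. h x) = h x" by (intro cSup_eq_maximum) auto
  then show thesis using that x by blast
qed

lemma continuous_on_SUP_unit_interval:
  fixes h :: "'a::metric_space \<Rightarrow> real \<Rightarrow> real"
  assumes comp: "compact (UNIV :: 'a set)" and h: "continuous_on UNIV (\<lambda>(\<theta>, x). h \<theta> x)"
  shows "continuous_on UNIV (\<lambda>\<theta>. SUP x\<in>{0..1}. h \<theta> x)"
  unfolding continuous_on_iff
proof (intro ballI allI impI)
  fix \<theta> :: 'a and e :: real assume "e > 0"
  have cont: "continuous_on {0..1} (h \<theta>)" for \<theta>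
    using continuous_on_compose2[OF h, of "{0..1}" "\<lambda>x. (\<theta>, x)"]
    by (simp add: continuous_on_Pair)
  have "compact ((UNIV :: 'a set) \<times> {0..1::real})" using comp by (intro compact_Times compact_Icc)
  then have "uniformly_continuous_on (UNIV \<times> {0..1}) (\<lambda>(\<theta>, x). h \<theta> x)"
    by (rule compact_uniformly_continuous[OF continuous_on_subset[OF h subset_UNIV]])
  then have "\<exists>d>0. \<forall>p\<in>UNIV \<times> {0..1}. \<forall>q\<in>UNIV \<times> {0..1}. dist q p < d
      \<longrightarrow> dist (case q of (\<theta>, x) \<Rightarrow> h \<theta> x) (case p of (\<theta>, x) \<Rightarrow> h \<theta> x) < e"
    using \<open>e > 0\<close> unfolding uniformly_continuous_on_def by blast
  then obtain d where d: "d > 0" "\<And>p q. p \<in> UNIV \<times> {0..1} \<Longrightarrow> q \<in> UNIV \<times> {0..1} \<Longrightarrow> dist q p < d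
      \<Longrightarrow> dist (case q of (\<theta>, x) \<Rightarrow> h \<theta> x) (case p of (\<theta>, x) \<Rightarrow> h \<theta> x) < e"
    by blast
  have close: "\<bar>h \<theta>1 x - h \<theta>2 x\<bar> < e" if "dist \<theta>1 \<theta>2 < d" "x \<in> {0..1}" for \<theta>1 \<theta>2 x
    using d(2)[of "(\<theta>2, x)" "(\<theta>1, x)"] that by (simp add: dist_Pair_Pair dist_real_def)
  have "dist (SUP x\<in>{0..1}. h \<theta>' x) (SUP x\<in>{0..1}. h \<theta> x) < e" if "dist \<theta>' \<theta> < d" for \<theta>'
  proof -
    obtain x where x: "x \<in> {0..1}" "(SUP x\<in>{0..1}. h \<theta> x) = h \<theta> x" "\<And>y. y \<in> {0..1} \<Longrightarrow> h \<theta> y \<le> h \<theta> x"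
      by (rule SUP_unit_interval_attained[OF cont[of \<theta>]]) (rule that)
    obtain x' where x': "x' \<in> {0..1}" "(SUP x\<in>{0..1}. h \<theta>' x) = h \<theta>' x'"
      "\<And>y. y \<in> {0..1} \<Longrightarrow> h \<theta>' y \<le> h \<theta>' x'"
      by (rule SUP_unit_interval_attained[OF cont[of \<theta>']]) (rule that)
    show ?thesis
      using x(3)[OF x'(1)] x'(3)[OF x(1)] close[OF that x(1)] close[OF that x'(1)]
      unfolding x(2) x'(2) dist_real_def by linarith
  qed
  then show "\<exists>d>0. \<forall>\<theta>'\<in>UNIV. dist \<theta>' \<theta> < d \<longrightarrow>
      dist (SUP x\<in>{0..1}. h \<theta>' x) (SUP x\<in>{0..1}. h \<theta> x) < e" using d(1) by blast
qed

section \<open>Iterates of a lift of degree one\<close>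

locale degree_one_lift =
  fixes r :: "'a::metric_space \<Rightarrow> 'a"
    and f :: "'a \<times> circle \<Rightarrow> 'a \<times> circle"
    and F :: "'a \<times> real \<Rightarrow> 'a \<times> real"
  assumes compact_base: "compact (UNIV :: 'a set)"
    and cont_r: "continuous_on UNIV r"
    and lift: "continuous_lift r f F"
    and degree_one: "fibre_map F \<theta> (x + of_int k) = fibre_map F \<theta> x + of_int k"
begin

abbreviation it where "it \<equiv> fibre_iterate r F"

lemma lift_step: "f (\<theta>, circle_proj x) = (r \<theta>, circle_proj (fibre_map F \<theta> x))"
proof -
  have "(f \<circ> cover_proj) (\<theta>, x) = (cover_proj \<circ> F) (\<theta>, x)" "fst (F (\<theta>, x)) = r \<theta>"
    using lift unfolding continuous_lift_def by simp_all
  then show ?thesis by (simp add: cover_proj_def fibre_map_def case_prod_unfold)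
qed

lemma lift_iterate: "(f ^^ n) (\<theta>, circle_proj x) = ((r ^^ n) \<theta>, circle_proj (it n \<theta> x))"
  by (induction n) (simp_all add: lift_step)

lemma it_add: "it (m + n) \<theta> x = it m ((r ^^ n) \<theta>) (it n \<theta> x)"
  by (induction m) (simp_all add: funpow_add)

lemma it_shift: "it n \<theta> (x + of_int k) = it n \<theta> x + of_int k"
  by (induction n) (simp_all add: degree_one)

lemma continuous_funpow: "continuous_on UNIV (r ^^ n)"
proof (induction n)
  case (Suc n)
  then show ?case using continuous_on_compose2[OF cont_r] by (simp add: comp_def)
qed (simp add: id_def)

lemma continuous_fibre_map: "continuous_on UNIV (\<lambda>(\<theta>, x). fibre_map F \<theta> x)"
proof -
  have "continuous_on UNIV F" using lift by (simp add: continuous_lift_def)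
  then show ?thesis by (auto simp: fibre_map_def intro!: continuous_intros)
qed

lemma continuous_it: "continuous_on UNIV (\<lambda>(\<theta>, x). it n \<theta> x)"
proof (induction n)
  case 0
  show ?case by (simp add: case_prod_unfold continuous_on_snd)
next
  case (Suc n)
  have "continuous_on UNIV (\<lambda>p. (r ^^ n) (fst p))"
    by (rule continuous_on_compose2[OF continuous_funpow]) (auto intro: continuous_intros)
  moreover have "continuous_on UNIV (\<lambda>p. it n (fst p) (snd p))"
    using Suc by (simp add: case_prod_unfold)
  ultimately have "continuous_on UNIV (\<lambda>p. ((r ^^ n) (fst p), it n (fst p) (snd p)))"
    by (rule continuous_on_Pair)
  from continuous_on_compose2[OF continuous_fibre_map this]
  show ?case by (simp add: case_prod_unfold)
qed

lemma continuous_it_fibre: "continuous_on S (it n \<theta>)"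
proof -
  have "continuous_on S (\<lambda>x. (\<theta>, x))" by (intro continuous_intros)
  from continuous_on_compose2[OF continuous_it this] show ?thesis by simp
qed

definition max_displacement :: "nat \<Rightarrow> 'a \<Rightarrow> real" where
  "max_displacement n \<theta> = (SUP x\<in>{0..1}. it n \<theta> x - x)"

text \<open>A negated supremum, so that \<open>continuous_on_SUP_unit_interval\<close> serves both
  extremes.\<close>

definition min_displacement :: "nat \<Rightarrow> 'a \<Rightarrow> real" where
  "min_displacement n \<theta> = - (SUP x\<in>{0..1}. x - it n \<theta> x)"

lemma continuous_max_displacement: "continuous_on UNIV (max_displacement n)"
  unfolding max_displacement_def
  by (rule continuous_on_SUP_unit_interval[OF compact_base])
    (use continuous_it[of n] in \<open>auto simp: case_prod_unfold intro!: continuous_intros\<close>)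

lemma continuous_min_displacement: "continuous_on UNIV (min_displacement n)"
  unfolding min_displacement_def
  by (intro continuous_intros continuous_on_SUP_unit_interval[OF compact_base])
    (use continuous_it[of n] in \<open>auto simp: case_prod_unfold intro!: continuous_intros\<close>)

text \<open>The displacement has period 1 in the fibre, so extrema over \<open>[0,1]\<close> bound
  it on the whole line.\<close>

lemma displacement_shift: "it n \<theta> (frac x) - frac x = it n \<theta> x - x"
  using it_shift[of n \<theta> x "- \<lfloor>x\<rfloor>"] by (simp add: frac_def)

lemma max_displacement:
  shows "it n \<theta> y - y \<le> max_displacement n \<theta>"
    and "\<exists>x\<in>{0..1}. max_displacement n \<theta> = it n \<theta> x - x"
proof -
  have cont: "continuous_on {0..1} (\<lambda>x. it n \<theta> x - x)"
    by (intro continuous_on_diff continuous_it_fibre continuous_on_id)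
  obtain x where x: "x \<in> {0..1}" "max_displacement n \<theta> = it n \<theta> x - x"
    "\<And>y. y \<in> {0..1} \<Longrightarrow> it n \<theta> y - y \<le> it n \<theta> x - x"
    by (rule SUP_unit_interval_attained[OF cont]) (rule that, simp_all add: max_displacement_def)
  then show "\<exists>x\<in>{0..1}. max_displacement n \<theta> = it n \<theta> x - x" by blast
  show "it n \<theta> y - y \<le> max_displacement n \<theta>"
    using x(3)[of "frac y"] x(2) frac_ge_0[of y] frac_lt_1[of y] displacement_shift[of n \<theta> y] by simp
qed

lemma min_displacement:
  shows "min_displacement n \<theta> \<le> it n \<theta> y - y"
    and "\<exists>x\<in>{0..1}. min_displacement n \<theta> = it n \<theta> x - x"
proof -
  have cont: "continuous_on {0..1} (\<lambda>x. x - it n \<theta> x)"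
    by (intro continuous_on_diff continuous_it_fibre continuous_on_id)
  obtain x where x: "x \<in> {0..1}" "- min_displacement n \<theta> = x - it n \<theta> x"
    "\<And>y. y \<in> {0..1} \<Longrightarrow> y - it n \<theta> y \<le> x - it n \<theta> x"
    by (rule SUP_unit_interval_attained[OF cont]) (rule that, simp_all add: min_displacement_def)
  then show "\<exists>x\<in>{0..1}. min_displacement n \<theta> = it n \<theta> x - x" by force
  show "min_displacement n \<theta> \<le> it n \<theta> y - y"
    using x(3)[of "frac y"] x(2) frac_ge_0[of y] frac_lt_1[of y] displacement_shift[of n \<theta> y] by simp
qed

lemma bounded_displacement:
  obtains C where "\<And>\<theta> x. \<bar>fibre_map F \<theta> x - x\<bar> \<le> C"
proof -
  have "bounded (range (max_displacement 1))" "bounded (range (min_displacement 1))"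
    by (intro compact_imp_bounded compact_continuous_image compact_base
        continuous_max_displacement continuous_min_displacement)+
  then obtain A B where AB: "\<And>\<theta>. \<bar>max_displacement 1 \<theta>\<bar> \<le> A" "\<And>\<theta>. \<bar>min_displacement 1 \<theta>\<bar> \<le> B"
    unfolding bounded_iff by auto
  have "\<bar>fibre_map F \<theta> x - x\<bar> \<le> max A B" for \<theta> x
    using max_displacement(1)[of 1 \<theta> x] min_displacement(1)[of 1 \<theta> x] AB(1)[of \<theta>] AB(2)[of \<theta>]
    by simp
  then show thesis using that by blast
qed

text \<open>The \<open>n\<close>-step displacement at time \<open>i\<close> lies between the
  extremes over \<open>(r ^^ i) \<theta>\<close>. By telescoping, these displacements sum to
  \<open>n\<close> times the total one, up to an error that disappears on division by
  \<open>K\<close>.\<close>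

lemma orbit_average_bounds:
  assumes C: "\<And>\<theta> x. \<bar>fibre_map F \<theta> x - x\<bar> \<le> C"
  shows "real n * ((it K \<theta> x - x) / real K) - 2 * real n * real n * C / real K
      \<le> birkhoff_avg r (max_displacement n) \<theta> K"
    and "birkhoff_avg r (min_displacement n) \<theta> K
      \<le> real n * ((it K \<theta> x - x) / real K) + 2 * real n * real n * C / real K"
proof -
  let ?z = "\<lambda>i. it i \<theta> x"
  have step: "?z (i + n) = it n ((r ^^ i) \<theta>) (?z i)" for i
    using it_add[of n i] by (simp add: add.commute)
  have "real n * (?z K - ?z 0) - 2 * real n * real n * C \<le> (\<Sum>i<K. ?z (i + n) - ?z i)"
    by (rule sum_shift_diff_lower_bound) (simp add: C)
  also have "\<dots> \<le> (\<Sum>i<K. max_displacement n ((r ^^ i) \<theta>))"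
    unfolding step by (intro sum_mono max_displacement)
  finally show "real n * ((it K \<theta> x - x) / real K) - 2 * real n * real n * C / real K
      \<le> birkhoff_avg r (max_displacement n) \<theta> K"
    unfolding birkhoff_avg_def
    by (simp add: diff_divide_distrib[symmetric] divide_right_mono)
  \<comment> \<open>The upper estimate is the lower estimate for the negated orbit.\<close>
  have "real n * (- ?z K - - ?z 0) - 2 * real n * real n * C \<le> (\<Sum>i<K. - ?z (i + n) - - ?z i)"
    by (rule sum_shift_diff_lower_bound) (use C in \<open>simp add: abs_minus_commute\<close>)
  moreover have "(\<Sum>i<K. min_displacement n ((r ^^ i) \<theta>)) \<le> (\<Sum>i<K. ?z (i + n) - ?z i)"
    unfolding step by (intro sum_mono min_displacement)
  ultimately have "(\<Sum>i<K. min_displacement n ((r ^^ i) \<theta>))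
      \<le> real n * (?z K - x) + 2 * real n * real n * C"
    by (simp add: sum_subtractf algebra_simps)
  then show "birkhoff_avg r (min_displacement n) \<theta> K
      \<le> real n * ((it K \<theta> x - x) / real K) + 2 * real n * real n * C / real K"
    unfolding birkhoff_avg_def
    by (simp add: add_divide_distrib[symmetric] divide_right_mono)
qed

text \<open>Only the limit superior of the rotation quotients is known, but the bounds on both sides
  converge, so it stays between their limits.\<close>

lemma rotation_number_bounds:
  assumes n: "n > 0" and \<rho>: "\<rho> \<in> fibred_rotation_interval r F"
    and a: "\<And>\<theta>. birkhoff_avg r (min_displacement n) \<theta> \<longlonglongrightarrow> a"
    and b: "\<And>\<theta>. birkhoff_avg r (max_displacement n) \<theta> \<longlonglongrightarrow> b"
  shows "a \<le> real n * \<rho>" and "real n * \<rho> \<le> b"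
proof -
  obtain C where C: "\<And>\<theta> x. \<bar>fibre_map F \<theta> x - x\<bar> \<le> C" using bounded_displacement by blast
  obtain \<theta> x where \<rho>: "ereal \<rho> = limsup (\<lambda>K. ereal ((it K \<theta> x - x) / real K))"
    using \<rho> unfolding fibred_rotation_interval_def by blast
  define D where "D = 2 * real n * real n * C"
  have D: "(\<lambda>K. D / real K) \<longlonglongrightarrow> 0" by real_asymp
  let ?u = "\<lambda>K. (it K \<theta> x - x) / real K"
  let ?M = "\<lambda>K. (birkhoff_avg r (max_displacement n) \<theta> K + D / real K) / real n"
  let ?m = "\<lambda>K. (birkhoff_avg r (min_displacement n) \<theta> K - D / real K) / real n"
  have "?u K \<le> ?M K" for K
  proof -
    have "?u K * real n \<le> birkhoff_avg r (max_displacement n) \<theta> K + D / real K"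
      using orbit_average_bounds(1)[OF C, of n K \<theta> x] unfolding D_def by (simp add: mult.commute)
    then show ?thesis using n by (subst pos_le_divide_eq) auto
  qed
  then have "ereal \<rho> \<le> limsup (\<lambda>K. ereal (?M K))"
    unfolding \<rho> by (intro Limsup_mono always_eventually) simp
  also have "?M \<longlonglongrightarrow> (b + 0) / real n" using n by (intro tendsto_intros b D) auto
  then have "(\<lambda>K. ereal (?M K)) \<longlonglongrightarrow> ereal (b / real n)" by simp
  then have "limsup (\<lambda>K. ereal (?M K)) = ereal (b / real n)"
    by (rule lim_imp_Limsup[OF sequentially_bot])
  finally show "real n * \<rho> \<le> b" using n by (simp add: field_simps)
  have "?m K \<le> ?u K" for K
  proof -
    have "birkhoff_avg r (min_displacement n) \<theta> K - D / real K \<le> ?u K * real n"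
      using orbit_average_bounds(2)[OF C, of n \<theta> K x] unfolding D_def by (simp add: mult.commute)
    then show ?thesis using n by (subst pos_divide_le_eq) auto
  qed
  then have *: "limsup (\<lambda>K. ereal (?m K)) \<le> ereal \<rho>"
    unfolding \<rho> by (intro Limsup_mono always_eventually) simp
  have "?m \<longlonglongrightarrow> (a - 0) / real n" using n by (intro tendsto_intros a D) auto
  then have "(\<lambda>K. ereal (?m K)) \<longlonglongrightarrow> ereal (a / real n)" by simp
  then have "limsup (\<lambda>K. ereal (?m K)) = ereal (a / real n)"
    by (rule lim_imp_Limsup[OF sequentially_bot])
  with * show "a \<le> real n * \<rho>" using n by (simp add: field_simps)
qed

end

section \<open>Separated points in a fibre\<close>
context degree_one_lift
begin

text \<open>The scale is tuned to tracking an integer: if the difference of two lifts is within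
  \<epsilon> of an integer, then one step later it is within 1/4 of the same integer, and no other
  integer is then within \<epsilon>.\<close>

lemma uniform_expansion_scale:
  obtains \<epsilon> where "0 < \<epsilon>" "\<epsilon> < 1/4"
    "\<And>\<theta> x y. \<bar>x - y\<bar> \<le> \<epsilon> \<Longrightarrow> \<bar>fibre_map F \<theta> x - fibre_map F \<theta> y\<bar> < 1/4"
proof -
  have "compact ((UNIV :: 'a set) \<times> {-1..2::real})"
    using compact_base by (intro compact_Times compact_Icc)
  then have "uniformly_continuous_on (UNIV \<times> {-1..2}) (\<lambda>(\<theta>, x). fibre_map F \<theta> x)"
    by (rule compact_uniformly_continuous[OF continuous_on_subset[OF continuous_fibre_map subset_UNIV]])
  then have "\<exists>d>0. \<forall>p\<in>UNIV \<times> {-1..2}. \<forall>q\<in>UNIV \<times> {-1..2}. dist q p < d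
      \<longrightarrow> dist (case q of (\<theta>, x) \<Rightarrow> fibre_map F \<theta> x) (case p of (\<theta>, x) \<Rightarrow> fibre_map F \<theta> x) < 1/4"
    unfolding uniformly_continuous_on_def by (elim allE[of _ "1/4"]) simp
  then obtain d where d: "d > 0" "\<And>p q. p \<in> UNIV \<times> {-1..2} \<Longrightarrow> q \<in> UNIV \<times> {-1..2} \<Longrightarrow> dist q p < d
      \<Longrightarrow> dist (case q of (\<theta>, x) \<Rightarrow> fibre_map F \<theta> x) (case p of (\<theta>, x) \<Rightarrow> fibre_map F \<theta> x) < 1/4"
    by blast
  define \<epsilon> where "\<epsilon> = min (d / 2) (1/8)"
  have \<epsilon>: "0 < \<epsilon>" "\<epsilon> < d" "\<epsilon> < 1/4" using d(1) by (auto simp: \<epsilon>_def)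
  have "\<bar>fibre_map F \<theta> x - fibre_map F \<theta> y\<bar> < 1/4" if "\<bar>x - y\<bar> \<le> \<epsilon>" for \<theta> x y
  proof -
    \<comment> \<open>Translation by the integer part of \<open>x\<close> moves \<open>x\<close>
      into \<open>[0,1]\<close>; the strip \<open>[-1,2]\<close> leaves room for
      \<open>y\<close>.\<close>
    define x' y' where "x' = x + of_int (- \<lfloor>x\<rfloor>)" and "y' = y + of_int (- \<lfloor>x\<rfloor>)"
    have x': "0 \<le> x'" "x' \<le> 1" unfolding x'_def by linarith+
    moreover have "\<bar>x' - y'\<bar> \<le> \<epsilon>" using that by (simp add: x'_def y'_def)
    ultimately have "x' \<in> {-1..2}" "y' \<in> {-1..2}" "dist x' y' < d"
      using \<epsilon> by (auto simp: dist_real_def)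
    then have "dist (fibre_map F \<theta> x') (fibre_map F \<theta> y') < 1/4"
      using d(2)[of "(\<theta>, y')" "(\<theta>, x')"] by (simp add: dist_Pair_Pair)
    then show ?thesis unfolding x'_def y'_def degree_one by (simp add: dist_real_def)
  qed
  then show thesis using that \<epsilon> by blast
qed

definition oscillation :: "nat \<Rightarrow> 'a \<Rightarrow> real" where
  "oscillation n \<theta> = max_displacement n \<theta> - min_displacement n \<theta>"

text \<open>
  Two points of $[0,1]$ whose orbits stay close on the circle differ in the cover by an integer $j$
  with $|j| \le 1$ up to a small error, and $j$ cannot change along the orbit. So they cannot end up
  exactly 2 apart.
\<close>

lemma separated_preimages:
  assumes n: "n > 0" and \<epsilon>: "0 < \<epsilon>" "\<epsilon> < 1/4"
    "\<And>\<theta> x y. \<bar>x - y\<bar> \<le> \<epsilon> \<Longrightarrow> \<bar>fibre_map F \<theta> x - fibre_map F \<theta> y\<bar> < 1/4"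
    and osc: "oscillation n \<theta> \<ge> 4"
  obtains u v where "(f ^^ n) (\<theta>, u) = ((r ^^ n) \<theta>, c)" "(f ^^ n) (\<theta>, v) = ((r ^^ n) \<theta>, c)"
    "\<exists>i<n. dist ((f ^^ i) (\<theta>, u)) ((f ^^ i) (\<theta>, v)) > \<epsilon>"
proof -
  obtain x1 x2 where x1: "x1 \<in> {0..1}" "max_displacement n \<theta> = it n \<theta> x1 - x1"
    and x2: "x2 \<in> {0..1}" "min_displacement n \<theta> = it n \<theta> x2 - x2"
    using max_displacement(2) min_displacement(2) by meson
  have gap: "it n \<theta> x1 \<ge> it n \<theta> x2 + 3"
    using osc x1 x2 by (simp add: oscillation_def)
  have "connected (it n \<theta> ` {0..1})"
    by (intro connected_continuous_image continuous_it_fibre connected_Icc)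
  then have sub: "{it n \<theta> x2..it n \<theta> x1} \<subseteq> it n \<theta> ` {0..1}"
    using x1 x2 by (intro connected_contains_Icc) auto
  obtain y where y: "c = circle_proj y" using circle_proj_surj by blast
  \<comment> \<open>The lift of \<open>c\<close> in the first unit of an interval of length 3, so
    that \<open>z + 2\<close> still lies in the interval.\<close>
  define z where "z = y + of_int \<lceil>it n \<theta> x2 - y\<rceil>"
  have c: "circle_proj z = c" "circle_proj (z + 2) = c"
    using circle_proj_add_int[of z 2] by (simp_all add: z_def y circle_proj_add_int)
  have "it n \<theta> x2 \<le> z" "z < it n \<theta> x2 + 1" unfolding z_def by linarith+
  then have "z \<in> it n \<theta> ` {0..1}" "z + 2 \<in> it n \<theta> ` {0..1}" using sub gap by auto
  then obtain a b where ab: "a \<in> {0..1}" "b \<in> {0..1}" "it n \<theta> a = z" "it n \<theta> b = z + 2"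
    by auto
  have "\<exists>i<n. dist ((f ^^ i) (\<theta>, circle_proj a)) ((f ^^ i) (\<theta>, circle_proj b)) > \<epsilon>"
  proof (rule ccontr)
    assume "\<not> ?thesis"
    then have "dist ((f ^^ i) (\<theta>, circle_proj a)) ((f ^^ i) (\<theta>, circle_proj b)) \<le> \<epsilon>" if "i < n" for i
      using that by (meson not_less)
    then have close: "dist (circle_proj (it i \<theta> a)) (circle_proj (it i \<theta> b)) \<le> \<epsilon>" if "i < n" for i
      using that by (simp add: lift_iterate dist_Pair_Pair)
    obtain j where j: "\<bar>a - b - of_int j\<bar> \<le> \<epsilon>"
      using close[OF n] circle_dist_obtains_int[of a b] by (metis fibre_iterate.simps(1) id_apply)
    have succ_close: "\<bar>it (Suc i) \<theta> a - it (Suc i) \<theta> b - of_int j\<bar> < 1/4"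
      if "\<bar>it i \<theta> a - it i \<theta> b - of_int j\<bar> \<le> \<epsilon>" for i
      using \<epsilon>(3)[of "it i \<theta> a" "it i \<theta> b + of_int j" "(r ^^ i) \<theta>"] that
      unfolding degree_one by (simp add: diff_diff_eq)
    have track: "\<bar>it i \<theta> a - it i \<theta> b - of_int j\<bar> \<le> \<epsilon>" if "i < n" for i
      using that
    proof (induction i)
      case 0
      then show ?case using j by simp
    next
      case (Suc i)
      obtain l where l: "dist (circle_proj (it (Suc i) \<theta> a)) (circle_proj (it (Suc i) \<theta> b))
          = \<bar>it (Suc i) \<theta> a - it (Suc i) \<theta> b - of_int l\<bar>"
        by (rule circle_dist_obtains_int)
      have "\<bar>it (Suc i) \<theta> a - it (Suc i) \<theta> b - of_int j\<bar> < 1/4" using Suc by (intro succ_close) simp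
      moreover have *: "\<bar>it (Suc i) \<theta> a - it (Suc i) \<theta> b - of_int l\<bar> \<le> \<epsilon>"
        using close[OF Suc.prems] unfolding l .
      ultimately have "\<bar>real_of_int j - real_of_int l\<bar> < 1" using \<epsilon>(2) by linarith
      then have "j = l" by linarith
      then show ?case using * by simp
    qed
    \<comment> \<open>Closeness is assumed only before time \<open>n\<close>; the last step is
      covered by the modulus alone, which weakens \<epsilon> to 1/4.\<close>
    obtain m where m: "n = Suc m" using n by (cases n) auto
    have "\<bar>it n \<theta> a - it n \<theta> b - of_int j\<bar> < 1/4"
      unfolding m by (rule succ_close, rule track) (simp add: m)
    then have "\<bar>- 2 - real_of_int j\<bar> < 1/4" by (simp add: ab)
    moreover have "\<bar>real_of_int j\<bar> < 3/2" using j ab(1,2) \<epsilon>(2) by auto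
    ultimately show False by linarith
  qed
  moreover have "(f ^^ n) (\<theta>, circle_proj a) = ((r ^^ n) \<theta>, c)" "(f ^^ n) (\<theta>, circle_proj b) = ((r ^^ n) \<theta>, c)"
    by (simp_all add: lift_iterate ab c)
  ultimately show thesis using that by blast
qed

section \<open>Pulling separated sets back along an orbit\<close>

lemma fibre_surjective: "\<exists>u. f (\<theta>, u) = (r \<theta>, c)"
proof -
  have eq: "it 1 \<theta> = fibre_map F \<theta>" by simp
  have "connected (it 1 \<theta> ` {0..1})"
    by (intro connected_continuous_image continuous_it_fibre connected_Icc)
  then have "{fibre_map F \<theta> 0..fibre_map F \<theta> 1} \<subseteq> fibre_map F \<theta> ` {0..1}"
    unfolding eq by (intro connected_contains_Icc) auto
  moreover have "fibre_map F \<theta> 1 = fibre_map F \<theta> 0 + 1" using degree_one[of \<theta> 0 1] by simp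
  moreover obtain y where y: "c = circle_proj y" using circle_proj_surj by blast
  define z where "z = y + of_int \<lceil>fibre_map F \<theta> 0 - y\<rceil>"
  have "fibre_map F \<theta> 0 \<le> z" "z \<le> fibre_map F \<theta> 0 + 1" unfolding z_def by linarith+
  ultimately have "z \<in> fibre_map F \<theta> ` {0..1}" by auto
  then obtain a where "z = fibre_map F \<theta> a" by blast
  moreover have "circle_proj z = c" by (simp add: z_def y circle_proj_add_int)
  ultimately show ?thesis using lift_step[of \<theta> a] by metis
qed

text \<open>A visit counts only if the block of \<open>n\<close> steps starting there ends by time
  \<open>K\<close>, since the doubling takes place within that block.\<close>

definition visits :: "nat \<Rightarrow> nat \<Rightarrow> 'a \<Rightarrow> nat set" where
  "visits n K \<theta> = {i. i + n \<le> K \<and> oscillation n ((r ^^ i) \<theta>) \<ge> 4}"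

lemma finite_visits: "finite (visits n K \<theta>)"
  by (rule finite_subset[of _ "{..K}"]) (auto simp: visits_def)

text \<open>If the oscillation at \<theta> is large, jump \<open>n\<close> steps and take two
  preimages of each point; otherwise move one step and take one. A jump passes at most
  \<open>n\<close> visits, which is why \<open>k\<close> doublings account for \<open>n * k\<close>
  of them.\<close>

lemma fibre_separated_set:
  assumes n: "n > 0" and \<epsilon>: "0 < \<epsilon>" "\<epsilon> < 1/4"
    "\<And>\<theta> x y. \<bar>x - y\<bar> \<le> \<epsilon> \<Longrightarrow> \<bar>fibre_map F \<theta> x - fibre_map F \<theta> y\<bar> < 1/4"
  shows "\<exists>E k. finite E \<and> card E = 2 ^ k \<and> card (visits n K \<theta>) \<le> n * k \<and>
    separated_set f K \<epsilon> (Pair \<theta> ` E)"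
proof (induction K arbitrary: \<theta> rule: less_induct)
  case (less K)
  consider "K < n" | "n \<le> K" "oscillation n \<theta> < 4" | "n \<le> K" "oscillation n \<theta> \<ge> 4" by linarith
  then show ?case
  proof cases
    case 1
    \<comment> \<open>No block of \<open>n\<close> steps fits, so any single point will do.\<close>
    then have "visits n K \<theta> = {}" by (auto simp: visits_def)
    then show ?thesis
      by (intro exI[of _ "{undefined}"] exI[of _ 0]) (simp add: separated_set_def)
  next
    case 2
    with n obtain L where L: "K = Suc L" by (cases K) auto
    obtain E k where E: "finite E" "card E = 2 ^ k" "card (visits n L (r \<theta>)) \<le> n * k"
      "separated_set f L \<epsilon> (Pair (r \<theta>) ` E)" using less[of L "r \<theta>"] L by blast
    obtain u where u: "\<And>c. f (\<theta>, u c) = (r \<theta>, c)" using fibre_surjective[of \<theta>] by metis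
    have "visits n K \<theta> \<subseteq> Suc ` visits n L (r \<theta>)"
    proof
      fix i assume i: "i \<in> visits n K \<theta>"
      then obtain j where "i = Suc j" using 2 by (cases i) (auto simp: visits_def)
      then show "i \<in> Suc ` visits n L (r \<theta>)"
        using i L by (auto simp: visits_def funpow_swap1)
    qed
    then have "card (visits n K \<theta>) \<le> card (visits n L (r \<theta>))"
      by (rule surj_card_le[OF finite_visits])
    moreover have "inj u" by (rule injI) (metis u prod.inject)
    then have "card (u ` E) = 2 ^ k" using E(2) by (simp add: card_image inj_on_subset)
    moreover have "separated_set f K \<epsilon> (Pair \<theta> ` u ` E)"
      unfolding separated_set_def
    proof (intro ballI impI)
      fix p q assume "p \<in> Pair \<theta> ` u ` E" "q \<in> Pair \<theta> ` u ` E" "p \<noteq> q"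
      then obtain c d where cd: "c \<in> E" "d \<in> E" "p = (\<theta>, u c)" "q = (\<theta>, u d)" "c \<noteq> d" by auto
      then obtain i where "i < L" "dist ((f ^^ i) (r \<theta>, c)) ((f ^^ i) (r \<theta>, d)) > \<epsilon>"
        using E(4) unfolding separated_set_def by blast
      then show "\<exists>i<K. dist ((f ^^ i) p) ((f ^^ i) q) > \<epsilon>"
        unfolding L cd by (intro exI[of _ "Suc i"]) (simp add: funpow_Suc_right u del: funpow.simps)
    qed
    ultimately show ?thesis using E(1,3) by (intro exI[of _ "u ` E"] exI[of _ k]) auto
  next
    case 3
    define L where "L = K - n"
    have K: "K = L + n" using 3 by (simp add: L_def)
    let ?\<theta> = "(r ^^ n) \<theta>"
    obtain E k where E: "finite E" "card E = 2 ^ k" "card (visits n L ?\<theta>) \<le> n * k"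
      "separated_set f L \<epsilon> (Pair ?\<theta> ` E)" using less[of L ?\<theta>] K n by auto
    have "\<exists>u v. (f ^^ n) (\<theta>, u) = (?\<theta>, c) \<and> (f ^^ n) (\<theta>, v) = (?\<theta>, c) \<and>
        (\<exists>i<n. dist ((f ^^ i) (\<theta>, u)) ((f ^^ i) (\<theta>, v)) > \<epsilon>)" for c
      by (rule separated_preimages[OF n \<epsilon>(1,2) _ 3(2), of c]) (use \<epsilon>(3) in blast)+
    then obtain u v where u: "\<And>c. (f ^^ n) (\<theta>, u c) = (?\<theta>, c)" and v: "\<And>c. (f ^^ n) (\<theta>, v c) = (?\<theta>, c)"
      and uv: "\<And>c. \<exists>i<n. dist ((f ^^ i) (\<theta>, u c)) ((f ^^ i) (\<theta>, v c)) > \<epsilon>" by metis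
    \<comment> \<open>Visits before time \<open>n\<close> fall into the jump; later ones are visits
      of the orbit of \<open>(r ^^ n) \<theta>\<close>.\<close>
    have "visits n K \<theta> \<subseteq> {..<n} \<union> (\<lambda>i. i + n) ` visits n L ?\<theta>"
    proof
      fix i assume i: "i \<in> visits n K \<theta>"
      show "i \<in> {..<n} \<union> (\<lambda>i. i + n) ` visits n L ?\<theta>"
      proof (cases "i < n")
        case False
        then obtain j where "i = j + n" by (metis add.commute le_Suc_ex not_less)
        then show ?thesis using i by (auto simp: visits_def funpow_add K)
      qed simp
    qed
    then have "card (visits n K \<theta>) \<le> card ({..<n} \<union> (\<lambda>i. i + n) ` visits n L ?\<theta>)"
      by (intro card_mono) (simp_all add: finite_visits)
    also have "\<dots> \<le> n + card (visits n L ?\<theta>)"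
      by (rule order_trans[OF card_Un_le]) (simp add: card_image_le finite_visits)
    also have "\<dots> \<le> n * Suc k" using E(3) by simp
    finally have visits: "card (visits n K \<theta>) \<le> n * Suc k" .
    have proj: "snd ((f ^^ n) (\<theta>, w c)) = c" if "w \<in> {u, v}" for w c
      using that u v by auto
    have base: "c = d" if "w \<in> {u, v}" "w' \<in> {u, v}" "w c = w' d" for w w' c d
      using proj[OF that(1), of c] proj[OF that(2), of d] that(3) by simp
    have neq: "u c \<noteq> v c" for c
    proof
      assume "u c = v c"
      then show False using uv[of c] \<epsilon>(1) by simp
    qed
    have inj: "inj u" "inj v" by (rule injI, rule base[of u u], simp_all, rule injI, rule base[of v v], simp_all)
    have "u ` E \<inter> v ` E = {}"
    proof (rule ccontr)
      assume "u ` E \<inter> v ` E \<noteq> {}"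
      then obtain c d where "u c = v d" by blast
      then show False using base[of u v c d] neq[of c] by simp
    qed
    then have card: "card (u ` E \<union> v ` E) = 2 ^ Suc k"
      using E(1,2) card_image[OF inj_on_subset[OF inj(1) subset_UNIV], of E]
        card_image[OF inj_on_subset[OF inj(2) subset_UNIV], of E]
      by (simp add: card_Un_disjoint)
    have "separated_set f K \<epsilon> (Pair \<theta> ` (u ` E \<union> v ` E))"
      unfolding separated_set_def
    proof (intro ballI impI)
      fix p q assume pq: "p \<in> Pair \<theta> ` (u ` E \<union> v ` E)" "q \<in> Pair \<theta> ` (u ` E \<union> v ` E)" "p \<noteq> q"
      obtain w c where w: "w \<in> {u, v}" "c \<in> E" "p = (\<theta>, w c)" using pq(1) by auto
      obtain w' d where w': "w' \<in> {u, v}" "d \<in> E" "q = (\<theta>, w' d)" using pq(2) by auto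
      show "\<exists>i<K. dist ((f ^^ i) p) ((f ^^ i) q) > \<epsilon>"
      \<comment> \<open>Two preimages of the same point separate during the jump; preimages of
        different points separate later, together with these points.\<close>
      proof (cases "c = d")
        case True
        then have "(w = u \<and> w' = v) \<or> (w = v \<and> w' = u)" using w w' pq(3) by auto
        moreover obtain i where "i < n" "dist ((f ^^ i) (\<theta>, u c)) ((f ^^ i) (\<theta>, v c)) > \<epsilon>"
          using uv by blast
        ultimately show ?thesis unfolding K w(3) w'(3) True
          by (intro exI[of _ i]) (auto simp: dist_commute True)
      next
        case False
        then obtain i where i: "i < L" "dist ((f ^^ i) (?\<theta>, c)) ((f ^^ i) (?\<theta>, d)) > \<epsilon>"
          using E(4) w(2) w'(2) unfolding separated_set_def by blast
        have "(f ^^ n) p = (?\<theta>, c)" "(f ^^ n) q = (?\<theta>, d)" using w w' u v by auto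
        then show ?thesis using i unfolding K
          by (intro exI[of _ "i + n"]) (simp add: funpow_add)
      qed
    qed
    then show ?thesis using visits card E(1)
      by (intro exI[of _ "u ` E \<union> v ` E"] exI[of _ "Suc k"]) simp
  qed
qed

text \<open>A Markov-type count: the oscillation is below 4 away from the good times and at most
  \<open>B\<close> at them, so an average above 6 forces good times of proportion at least
  \<open>2 / B\<close>.\<close>

lemma frequent_visits:
  assumes n: "n > 0" and c: "birkhoff_avg r (oscillation n) \<theta> \<longlonglongrightarrow> c" "c \<ge> 8"
  obtains B where "B > 0" "eventually (\<lambda>K. B * real K - real n \<le> real (card (visits n K \<theta>))) sequentially"
proof -
  have "continuous_on UNIV (oscillation n)" unfolding oscillation_def
    by (intro continuous_intros continuous_max_displacement continuous_min_displacement)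
  then have "bounded (range (oscillation n))"
    using compact_continuous_image[OF _ compact_base] compact_imp_bounded by blast
  then obtain B' where B': "\<And>\<theta>. \<bar>oscillation n \<theta>\<bar> \<le> B'" unfolding bounded_iff by auto
  define B where "B = max B' 1"
  have B: "\<And>\<theta>. oscillation n \<theta> \<le> B" "B > 0" using B' by (auto simp: B_def abs_le_iff le_max_iff_disj)
  have "eventually (\<lambda>K. birkhoff_avg r (oscillation n) \<theta> K > 6) sequentially"
    using c by (intro order_tendstoD(1)[OF c(1)]) simp
  then have "eventually (\<lambda>K. 2 / B * real K - real n \<le> real (card (visits n K \<theta>))) sequentially"
    using eventually_gt_at_top[of 0]
  proof eventually_elim
    case (elim K)
    let ?G = "{i\<in>{..<K}. oscillation n ((r ^^ i) \<theta>) \<ge> 4}"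
    have "6 * real K \<le> (\<Sum>i<K. oscillation n ((r ^^ i) \<theta>))"
      using elim by (simp add: birkhoff_avg_def field_simps)
    also have "\<dots> \<le> (\<Sum>i<K. 4 + B * indicator ?G i)"
    proof (rule sum_mono)
      fix i assume "i \<in> {..<K}"
      then show "oscillation n ((r ^^ i) \<theta>) \<le> 4 + B * indicator ?G i"
        using B(1)[of "(r ^^ i) \<theta>"] by (auto simp: indicator_def)
    qed
    also have "\<dots> = 4 * real K + B * (\<Sum>i<K. indicator ?G i)"
      by (simp add: sum.distrib sum_distrib_left)
    also have "(\<Sum>i<K. indicator ?G i :: real) = real (card ?G)"
    proof -
      have "(\<Sum>i<K. indicator ?G i :: real) = (\<Sum>i\<in>?G. 1)"
        by (intro sum.mono_neutral_cong_right) auto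
      then show ?thesis by simp
    qed
    finally have "2 / B * real K \<le> real (card ?G)" using B(2) by (simp add: field_simps)
    \<comment> \<open>Good times whose block leaves the window lie among the last \<open>n\<close>;
      this costs \<open>n\<close>.\<close>
    also have "card ?G \<le> card (visits n K \<theta> \<union> {K - n..<K})"
      by (intro card_mono finite_UnI finite_visits finite_atLeastLessThan) (auto simp: visits_def)
    also have "\<dots> \<le> card (visits n K \<theta>) + n"
      by (rule order_trans[OF card_Un_le]) simp
    finally show ?case by simp
  qed
  then show thesis using that[of "2 / B"] B(2) by simp
qed

text \<open>One fibre is enough. There are at least \<open>B * K / n - 1\<close> doublings, so at
  the fixed scale \<epsilon> the growth rate is at least \<open>(B / n) * ln 2\<close>.\<close>

lemma positive_entropy:
  assumes n: "n > 0" and c: "birkhoff_avg r (oscillation n) \<theta> \<longlonglongrightarrow> c" "c \<ge> 8"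
  shows "top_entropy f > 0"
proof -
  obtain \<epsilon> where \<epsilon>: "0 < \<epsilon>" "\<epsilon> < 1/4"
    "\<And>\<theta> x y. \<bar>x - y\<bar> \<le> \<epsilon> \<Longrightarrow> \<bar>fibre_map F \<theta> x - fibre_map F \<theta> y\<bar> < 1/4"
    using uniform_expansion_scale by blast
  obtain B where B: "B > 0"
    "eventually (\<lambda>K. B * real K - real n \<le> real (card (visits n K \<theta>))) sequentially"
    by (rule frequent_visits[OF n c])
  let ?S = "\<lambda>K. SUP E\<in>{E. finite E \<and> separated_set f K \<epsilon> E}. ereal (ln (real (card E)))"
  let ?l = "\<lambda>K. (B / real n - 1 / real K) * ln 2"
  have "eventually (\<lambda>K. ereal (?l K) \<le> ?S K / ereal (real K)) sequentially"
    using B(2) eventually_gt_at_top[of 0]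
  proof eventually_elim
    case (elim K)
    obtain E k where E: "finite E" "card E = 2 ^ k" "card (visits n K \<theta>) \<le> n * k"
      "separated_set f K \<epsilon> (Pair \<theta> ` E)"
      using fibre_separated_set[OF n \<epsilon>, of K \<theta>] by blast
    have card: "card (Pair \<theta> ` E) = 2 ^ k" using E(2) by (simp add: card_image inj_on_def)
    have "B * real K - real n \<le> real (n * k)" using elim(1) E(3) by linarith
    then have "B * real K / real n - 1 \<le> real k" using n by (simp add: field_simps)
    then have "(B * real K / real n - 1) * ln 2 \<le> real k * ln 2" by (intro mult_right_mono) auto
    moreover have "?l K = (B * real K / real n - 1) * ln 2 / real K" using elim(2) by (simp add: field_simps)
    ultimately have "?l K \<le> ln (real (card (Pair \<theta> ` E))) / real K"
      using elim(2) by (simp add: card ln_realpow divide_right_mono)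
    then have "ereal (?l K) \<le> ereal (ln (real (card (Pair \<theta> ` E)))) / ereal (real K)"
      using elim(2) by simp
    also have "\<dots> \<le> ?S K / ereal (real K)"
      using E(1,4) elim(2) by (intro ereal_divide_right_mono SUP_upper) auto
    finally show ?case .
  qed
  then have le: "limsup (\<lambda>K. ereal (?l K)) \<le> limsup (\<lambda>K. ?S K / ereal (real K))"
    by (rule Limsup_mono)
  have "(\<lambda>K. 1 / real K) \<longlonglongrightarrow> 0" by real_asymp
  then have "?l \<longlonglongrightarrow> (B / real n - 0) * ln 2" by (intro tendsto_intros)
  then have "(\<lambda>K. ereal (?l K)) \<longlonglongrightarrow> ereal (B / real n * ln 2)" by simp
  then have lim: "limsup (\<lambda>K. ereal (?l K)) = ereal (B / real n * ln 2)"
    by (rule lim_imp_Limsup[OF sequentially_bot])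
  have "0 < ereal (B / real n * ln 2)" using B(1) n by simp
  also have "\<dots> \<le> limsup (\<lambda>K. ?S K / ereal (real K))" using le unfolding lim .
  also have "\<dots> \<le> top_entropy f"
    unfolding top_entropy_def using \<epsilon>(1) by (intro SUP_upper) simp
  finally show ?thesis .
qed

end

theorem theorem2p3:
  fixes r :: "'a::metric_space \<Rightarrow> 'a"
    and f :: "'a \<times> circle \<Rightarrow> 'a \<times> circle"
    and F :: "'a \<times> real \<Rightarrow> 'a \<times> real"
  assumes "compact (UNIV :: 'a set)"
    and "uef_circle_endo r f"
    and "homotopic_to_identity r f"
    and "continuous_lift r f F"
    and "interior (fibred_rotation_interval r F) \<noteq> {}"
  shows "top_entropy f > 0"
proof -
  have r: "continuous_on UNIV r" "uniquely_ergodic r"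
    using assms(2) by (simp_all add: uef_circle_endo_def)
  interpret degree_one_lift r f F
    by unfold_locales (fact assms(1) r(1) assms(4) fibre_map_degree_one[OF assms(3,4)])+
  obtain \<rho> e where "e > 0" "ball \<rho> e \<subseteq> fibred_rotation_interval r F"
    using assms(5) by (auto simp: mem_interior)
  moreover have "\<rho> + e / 2 \<in> ball \<rho> e" "\<rho> \<in> ball \<rho> e" using \<open>e > 0\<close> by (auto simp: dist_real_def)
  ultimately have \<rho>: "\<rho> + e / 2 \<in> fibred_rotation_interval r F" "\<rho> \<in> fibred_rotation_interval r F"
    by blast+
  \<comment> \<open>The two chosen rotation numbers differ by \<open>e / 2\<close>, so
    \<open>n * e / 2 > 8\<close> gives the mean oscillation of at least 8 that
    \<open>positive_entropy\<close> asks for.\<close>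
  obtain n where "16 / e < real n" using reals_Archimedean2 by blast
  then have n: "16 < real n * e" using \<open>e > 0\<close> by (simp add: field_simps)
  then have "n > 0" by (cases n) auto
  obtain a where a: "\<And>\<theta>. birkhoff_avg r (min_displacement n) \<theta> \<longlonglongrightarrow> a"
    using uniquely_ergodic_birkhoff[OF assms(1) r continuous_min_displacement] by blast
  obtain b where b: "\<And>\<theta>. birkhoff_avg r (max_displacement n) \<theta> \<longlonglongrightarrow> b"
    using uniquely_ergodic_birkhoff[OF assms(1) r continuous_max_displacement] by blast
  have "a \<le> real n * \<rho>" by (rule rotation_number_bounds(1)[OF \<open>n > 0\<close> \<rho>(2) a b])
  moreover have "real n * (\<rho> + e / 2) \<le> b" by (rule rotation_number_bounds(2)[OF \<open>n > 0\<close> \<rho>(1) a b])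
  ultimately have "b - a \<ge> 8" using n by (simp add: algebra_simps)
  moreover have "birkhoff_avg r (oscillation n) \<theta> \<longlonglongrightarrow> b - a" for \<theta>
    using tendsto_diff[OF b[of \<theta>] a[of \<theta>]] unfolding oscillation_def birkhoff_avg_diff[symmetric] .
  ultimately show ?thesis using positive_entropy[OF \<open>n > 0\<close>] by blast
qed

end
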